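(* Let $G$ be a bounded abelian group. Then the following assertions are equivalent: (a) $|G|\ge\mathfrak c$; (b) $G$ admits a non-discrete locally minimal and locally GTG group topology; (c) $G$ admits a non-discrete locally compact metrizable group topology.
   Context: $\mathbb N=\{1,2,\dots\}$; $\mathfrak c=2^{\omega}$ is the cardinality of the continuum. An abelian group $G$ is bounded if $nG=\{0\}$ for some $n\in\mathbb N$. A Hausdorff group topology $\tau$ on $G$ is locally minimal if there exists a $\tau$-neighborhood $V$ of $0$ such that whenever $\sigma\le\tau$ is a Hausdorff group topology on $G$ such that $V$ is a $\sigma$-neighborhood of $0$, then $\sigma=\tau$. For a symmetric subset $U\ni 0$ of $G$ and $n\in\mathbb N$ put $(1/n)U=\{x\in G: kx\in U\ \text{for all } k\in\{1,\dots,n\}\}$; $U$ is a GTG subset if the sets $(1/n)U$, $n\in\mathbb N$, form a basis of neighborhoods of zero for a (not necessarily Hausdorff) group topology on $G$. A Hausdorff group topology on an abelian group is locally GTG if it has a basis of (not necessarily open) neighborhoods of $0$ formed by GTG subsets. *)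

theory Defs
  imports "HOL-Analysis.Analysis"
begin

text \<open>
  Abelian groups are types of class \<^class>\<open>ab_group_add\<close>. A group may carry many topologies,
  so topologies on it are values of type \<^typ>\<open>'a topology\<close> with full carrier.
\<close>

primrec nat_mult :: "nat \<Rightarrow> 'a::ab_group_add \<Rightarrow> 'a" where
  "nat_mult 0 x = 0"
| "nat_mult (Suc n) x = x + nat_mult n x"

definition group_topology :: "'a::ab_group_add topology \<Rightarrow> bool" where
  "group_topology T \<longleftrightarrow>
     topspace T = UNIV \<and>
     continuous_map (prod_topology T T) T (\<lambda>(x, y). x + y) \<and>
     continuous_map T T (\<lambda>x. - x)"

definition Hausdorff_group_topology :: "'a::ab_group_add topology \<Rightarrow> bool" where
  "Hausdorff_group_topology T \<longleftrightarrow> group_topology T \<and> Hausdorff_space T"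

definition zero_nbhd :: "'a::ab_group_add topology \<Rightarrow> 'a set \<Rightarrow> bool" where
  "zero_nbhd T V \<longleftrightarrow> (\<exists>W. openin T W \<and> 0 \<in> W \<and> W \<subseteq> V)"

definition coarser :: "'a topology \<Rightarrow> 'a topology \<Rightarrow> bool" where
  "coarser S T \<longleftrightarrow> (\<forall>W. openin S W \<longrightarrow> openin T W)"

definition locally_minimal :: "'a::ab_group_add topology \<Rightarrow> bool" where
  "locally_minimal T \<longleftrightarrow>
     Hausdorff_group_topology T \<and>
     (\<exists>V. zero_nbhd T V \<and>
        (\<forall>S. Hausdorff_group_topology S \<and> coarser S T \<and> zero_nbhd S V \<longrightarrow> S = T))"

text \<open>\<open>frac_set n U\<close> is the set written $(1/n)U$.\<close>

definition frac_set :: "nat \<Rightarrow> 'a::ab_group_add set \<Rightarrow> 'a set" where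
  "frac_set n U = {x. \<forall>k\<in>{1..n}. nat_mult k x \<in> U}"

text \<open>The topology witnessing the GTG property need be neither Hausdorff nor related to any
  topology already present on the group.\<close>

definition GTG_subset :: "'a::ab_group_add set \<Rightarrow> bool" where
  "GTG_subset U \<longleftrightarrow>
     uminus ` U = U \<and> 0 \<in> U \<and>
     (\<exists>S. group_topology S \<and>
        (\<forall>n\<ge>1. zero_nbhd S (frac_set n U)) \<and>
        (\<forall>V. zero_nbhd S V \<longrightarrow> (\<exists>n\<ge>1. frac_set n U \<subseteq> V)))"

text \<open>In \<^const>\<open>neighbourhood_base_at\<close> the basic neighbourhoods need not be open.\<close>

definition locally_GTG :: "'a::ab_group_add topology \<Rightarrow> bool" where
  "locally_GTG T \<longleftrightarrow> Hausdorff_group_topology T \<and> neighbourhood_base_at 0 GTG_subset T"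

end

theory Submission
  imports Defs "HOL-Computational_Algebra.Primes" "HOL-Library.Function_Algebras"
begin

text \<open>
  In a group of exponent \<open>n\<close>, \<open>(1/n)U\<close> is the least of the sets \<open>(1/k)U\<close>; if \<open>U\<close> is GTG it is therefore
  a subgroup, so a locally GTG topology has a base of open subgroups. If it is moreover locally
  minimal and non-discrete, then for some prime \<open>p\<close> the \<open>p\<close>-torsion \<open>S\<close> of a small open subgroup
  is non-discrete, and it inherits minimality among linear topologies. Minimality first makes open
  subgroups of \<open>S\<close> have finite index (compare with the topology of open hyperplanes) and then makes
  \<open>S\<close> complete (a missing limit \<open>z\<close> could be divided out), so \<open>S\<close> contains a Cantor set. A non-discrete
  locally compact metrizable group is perfect and hence also of size at least the continuum.
  Conversely, a bounded group of size at least the continuum has, for some prime \<open>p\<close>, that many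
  independent elements of order \<open>p\<close>, so \<open>(\<int>/p)\<^sup>\<omega>\<close> embeds algebraically; declaring its compact
  metrizable topology open gives a topology as required in both (b) and (c).
\<close>

subsection \<open>Multiples and subgroups\<close>

text \<open>The subgroup S need not be open, so its minimality has to be earned: a coarser linear
  topology on S with base \<open>\<B>\<close> is spread over the whole group by the sums N + B,
  where N runs through the open subgroups contained in a fixed open subgroup inside the
  neighbourhood witnessing local minimality. Sums stay in that subgroup, and they separate points
  because p kills every B. Exponent p turns S into a vector space over Z/p. Open hyperplanes missing
  a given point then exist, and they have index p. Moreover a nonzero multiple of z lying in S
  would, by invertibility modulo p, put z itself into S; so the group generated by a missing limit z
  meets S only in 0, which is exactly why dividing it out leaves a Hausdorff topology on S. Finite
  index is total boundedness. It lets a maximal family of cosets with the finite intersection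
  property select a coset of every open subgroup, and thus act as a point of the completion, which
  is never constructed.\<close>

lemma nat_mult_zero [simp]: "nat_mult n 0 = 0"
  by (induction n) auto

lemma nat_mult_plus: "nat_mult n (x + y) = nat_mult n x + nat_mult n y"
  by (induction n) (auto simp: algebra_simps)

lemma nat_mult_minus: "nat_mult n (- x) = - nat_mult n x"
  by (induction n) (auto simp: algebra_simps)

lemma nat_mult_diff: "nat_mult n (x - y) = nat_mult n x - nat_mult n y"
  using nat_mult_plus[of n x "- y"] by (simp add: nat_mult_minus)

lemma nat_mult_add: "nat_mult (m + n) x = nat_mult m x + nat_mult n x"
  by (induction m) (auto simp: algebra_simps)

lemma nat_mult_mult: "nat_mult (m * n) x = nat_mult m (nat_mult n x)"
  by (induction m) (auto simp: nat_mult_add)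

lemma nat_mult_dvd: "nat_mult m x = 0 \<Longrightarrow> m dvd n \<Longrightarrow> nat_mult n x = 0"
  by (metis dvd_def mult.commute nat_mult_mult nat_mult_zero)

definition subgrp :: "'a::ab_group_add set \<Rightarrow> bool" where
  "subgrp H \<longleftrightarrow> 0 \<in> H \<and> (\<forall>x\<in>H. \<forall>y\<in>H. x - y \<in> H)"

lemma subgrp_zero: "subgrp H \<Longrightarrow> 0 \<in> H"
  by (simp add: subgrp_def)

lemma subgrp_diff: "subgrp H \<Longrightarrow> x \<in> H \<Longrightarrow> y \<in> H \<Longrightarrow> x - y \<in> H"
  by (simp add: subgrp_def)

lemma subgrp_minus: "subgrp H \<Longrightarrow> x \<in> H \<Longrightarrow> - x \<in> H"
  using subgrp_diff[of H 0 x] by (simp add: subgrp_zero)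

lemma subgrp_add: "subgrp H \<Longrightarrow> x \<in> H \<Longrightarrow> y \<in> H \<Longrightarrow> x + y \<in> H"
  using subgrp_diff[of H x "- y"] by (simp add: subgrp_minus)

lemma subgrp_mult: "subgrp H \<Longrightarrow> x \<in> H \<Longrightarrow> nat_mult n x \<in> H"
  by (induction n) (auto intro: subgrp_zero subgrp_add)

lemma subgrp_Int: "subgrp A \<Longrightarrow> subgrp B \<Longrightarrow> subgrp (A \<inter> B)"
  by (simp add: subgrp_def)

lemma subgrp_torsion: "subgrp {x. nat_mult n x = 0}"
  by (simp add: subgrp_def nat_mult_diff)

lemma subgrp_Union_chain:
  assumes "subset.chain {H. subgrp H} C" "C \<noteq> {}"
  shows "subgrp (\<Union>C)"
proof -
  have sub: "subgrp H" if "H \<in> C" for H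
    using assms that by (auto simp: subset_chain_def)
  show ?thesis
    unfolding subgrp_def
  proof (intro conjI ballI)
    show "0 \<in> \<Union>C" using assms(2) sub subgrp_zero by blast
  next
    fix x y assume "x \<in> \<Union>C" "y \<in> \<Union>C"
    then obtain X Y where XY: "X \<in> C" "Y \<in> C" "x \<in> X" "y \<in> Y" by blast
    then have "X \<subseteq> Y \<or> Y \<subseteq> X" using assms(1) by (auto simp: subset_chain_def)
    then show "x - y \<in> \<Union>C"
      using XY sub subgrp_diff by (metis UnionI subsetD)
  qed
qed

text \<open>For \<open>y\<close> of finite order modulo \<open>A\<close>, \<open>adj A y\<close> is the subgroup \<open>A + \<langle>y\<rangle>\<close>.\<close>

definition adj :: "'a::ab_group_add set \<Rightarrow> 'a \<Rightarrow> 'a set" where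
  "adj A y = {x. \<exists>k. x - nat_mult k y \<in> A}"

lemma adj_subset: "A \<subseteq> adj A y"
  unfolding adj_def by (auto intro: exI[of _ 0])

lemma adj_self: "subgrp A \<Longrightarrow> y \<in> adj A y"
  unfolding adj_def by (auto intro!: exI[of _ "Suc 0"] simp: subgrp_zero)

lemma adj_subset_subgrp: "subgrp S \<Longrightarrow> A \<subseteq> S \<Longrightarrow> y \<in> S \<Longrightarrow> adj A y \<subseteq> S"
  unfolding adj_def by clarsimp (metis diff_add_cancel subgrp_add subgrp_mult subsetD)

text \<open>\<open>adj\<close> uses only nonnegative multiples; since n y lies in A, -y is congruent
  to (n - 1) y modulo A, which supplies the negative ones.\<close>

lemma subgrp_adj:
  assumes A: "subgrp A" and n: "n \<ge> 1" "nat_mult n y \<in> A"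
  shows "subgrp (adj A y)"
  unfolding subgrp_def
proof (intro conjI ballI)
  show "0 \<in> adj A y" using adj_subset A subgrp_zero by blast
next
  fix x x' assume "x \<in> adj A y" "x' \<in> adj A y"
  then obtain k k' where k: "x - nat_mult k y \<in> A" "x' - nat_mult k' y \<in> A"
    by (auto simp: adj_def)
  obtain m where m: "n = Suc m" using n by (cases n) auto
  have "(x - nat_mult k y) - (x' - nat_mult k' y) - nat_mult k' (nat_mult n y) \<in> A"
    by (intro subgrp_diff[OF A subgrp_diff[OF A k]] subgrp_mult[OF A n(2)])
  also have "(x - nat_mult k y) - (x' - nat_mult k' y) - nat_mult k' (nat_mult n y)
     = (x - x') - nat_mult (k + k' * m) y"
    by (simp add: m nat_mult_add nat_mult_mult nat_mult_plus algebra_simps)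
  finally show "x - x' \<in> adj A y" unfolding adj_def by blast
qed

lemma prime_inverse:
  fixes p k :: nat
  assumes "prime p" "\<not> p dvd k"
  obtains l z where "k * l = p * z + 1"
proof -
  have "coprime k p" using prime_imp_coprime[of p k] assms by (simp add: coprime_commute)
  moreover have "k \<noteq> 0" using assms by (metis dvd_0_right)
  ultimately show ?thesis using bezout_nat[of k p] that by (metis coprime_imp_gcd_eq_1)
qed

text \<open>k is invertible modulo p, so y is an integer combination of k y and p y.\<close>

lemma mem_if_prime_mult:
  assumes A: "subgrp A" and p: "prime p" "nat_mult p y \<in> A" and k: "\<not> p dvd k" "nat_mult k y \<in> A"
  shows "y \<in> A"
proof -
  obtain l z where "k * l = p * z + 1" using prime_inverse p k by metis
  then have "nat_mult (l * k) y = nat_mult (z * p + 1) y" by (simp add: mult.commute)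
  then have "y = nat_mult l (nat_mult k y) - nat_mult z (nat_mult p y)"
    by (simp add: nat_mult_add nat_mult_mult)
  then show ?thesis using A p k by (metis subgrp_diff subgrp_mult)
qed

text \<open>Steinitz exchange modulo A. The coefficient k of y in x is prime to p, since otherwise k
  y and hence x would lie in A; so the relation can be solved for y.\<close>

lemma adj_exchange:
  assumes A: "subgrp A" and p: "prime p" "nat_mult p y \<in> A"
    and x: "x \<in> adj A y" "x \<notin> A"
  shows "y \<in> adj A x"
proof -
  obtain k where k: "x - nat_mult k y \<in> A" using x by (auto simp: adj_def)
  have "\<not> p dvd k"
  proof
    assume "p dvd k"
    then obtain j where "k = j * p" by (metis dvd_def mult.commute)
    then have "nat_mult k y \<in> A" using A p by (simp add: nat_mult_mult subgrp_mult)
    then show False using k x A by (metis diff_add_cancel subgrp_add)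
  qed
  then obtain l z where "k * l = p * z + 1" using prime_inverse p by metis
  then have "nat_mult (l * k) y = nat_mult (z * p + 1) y" by (simp add: mult.commute)
  then have "nat_mult l (nat_mult k y) = nat_mult z (nat_mult p y) + y"
    by (simp add: nat_mult_add nat_mult_mult)
  then have "y - nat_mult l x = - (nat_mult l (x - nat_mult k y)) - nat_mult z (nat_mult p y)"
    by (simp add: nat_mult_diff)
  also have "\<dots> \<in> A" by (intro subgrp_diff[OF A] subgrp_minus[OF A] subgrp_mult[OF A k] subgrp_mult[OF A p(2)])
  finally show ?thesis unfolding adj_def by blast
qed

subsection \<open>Group topologies and neighbourhoods of zero\<close>

lemma group_topology_topspace: "group_topology T \<Longrightarrow> topspace T = UNIV"
  by (simp add: group_topology_def)

lemma continuous_map_translate: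
  assumes "group_topology T"
  shows "continuous_map T T (\<lambda>y. x + y)"
proof -
  have "continuous_map T (prod_topology T T) (\<lambda>y. (x, y))"
    using assms by (simp add: group_topology_def continuous_map_pairedI)
  from continuous_map_compose[OF this, of T "\<lambda>(x, y). x + y"] show ?thesis
    using assms by (simp add: group_topology_def o_def)
qed

lemma zero_nbhd_mono: "zero_nbhd T U \<Longrightarrow> U \<subseteq> V \<Longrightarrow> zero_nbhd T V"
  unfolding zero_nbhd_def by blast

lemma zero_nbhd_mem: "zero_nbhd T U \<Longrightarrow> 0 \<in> U"
  unfolding zero_nbhd_def by blast

lemma zero_nbhd_Int: "zero_nbhd T U \<Longrightarrow> zero_nbhd T V \<Longrightarrow> zero_nbhd T (U \<inter> V)"
  unfolding zero_nbhd_def by (metis Int_iff Int_mono openin_Int)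

lemma zero_nbhd_UNIV: "group_topology T \<Longrightarrow> zero_nbhd T UNIV"
  unfolding zero_nbhd_def by (metis group_topology_topspace openin_topspace UNIV_I subset_UNIV)

lemma zero_nbhd_open: "openin T U \<Longrightarrow> 0 \<in> U \<Longrightarrow> zero_nbhd T U"
  unfolding zero_nbhd_def by blast

lemma openin_translate:
  assumes "group_topology T" "openin T U"
  shows "openin T {y. x + y \<in> U}"
  using openin_continuous_map_preimage[OF continuous_map_translate[OF assms(1)] assms(2)] assms(1)
  by (simp add: group_topology_topspace)

text \<open>Translations are continuous. This reduces all comparisons of group topologies (coarser,
  equal, discrete) to their neighbourhoods of zero.\<close>

lemma openin_iff_zero_nbhd:
  assumes T: "group_topology T"
  shows "openin T U \<longleftrightarrow> (\<forall>x\<in>U. zero_nbhd T {y. x + y \<in> U})"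
proof
  assume "openin T U"
  then show "\<forall>x\<in>U. zero_nbhd T {y. x + y \<in> U}"
    using openin_translate[OF T] by (auto intro!: zero_nbhd_open)
next
  assume R: "\<forall>x\<in>U. zero_nbhd T {y. x + y \<in> U}"
  show "openin T U"
  proof (subst openin_subopen, intro ballI)
    fix x assume "x \<in> U"
    then obtain W where W: "openin T W" "0 \<in> W" "W \<subseteq> {y. x + y \<in> U}"
      using R unfolding zero_nbhd_def by blast
    have "openin T {y. - x + y \<in> W}" using openin_translate[OF T W(1)] .
    moreover have "x \<in> {y. - x + y \<in> W}" using W by simp
    moreover have "{y. - x + y \<in> W} \<subseteq> U"
    proof
      fix y assume "y \<in> {y. - x + y \<in> W}"
      then have "x + (- x + y) \<in> U" using W(3) by blast
      then show "y \<in> U" by simp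
    qed
    ultimately show "\<exists>V. openin T V \<and> x \<in> V \<and> V \<subseteq> U" by blast
  qed
qed

lemma coarser_if_zero_nbhd:
  assumes "group_topology S" "group_topology T" "\<And>V. zero_nbhd S V \<Longrightarrow> zero_nbhd T V"
  shows "coarser S T"
  unfolding coarser_def using assms by (simp add: openin_iff_zero_nbhd)

lemma group_topology_eqI:
  assumes "group_topology S" "group_topology T" "\<And>V. zero_nbhd S V \<longleftrightarrow> zero_nbhd T V"
  shows "S = T"
  using assms by (simp add: topology_eq openin_iff_zero_nbhd)

lemma discrete_iff_zero_nbhd:
  assumes "group_topology T"
  shows "T = discrete_topology UNIV \<longleftrightarrow> zero_nbhd T {0}"
proof
  assume "zero_nbhd T {0}"
  then have "openin T U" for U
    using assms by (auto simp: openin_iff_zero_nbhd intro: zero_nbhd_mono)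
  then show "T = discrete_topology UNIV" by (simp add: topology_eq)
qed (auto simp: zero_nbhd_def)

lemma zero_nbhd_add:
  assumes T: "group_topology T" and V: "zero_nbhd T V"
  shows "\<exists>W. zero_nbhd T W \<and> (\<forall>x\<in>W. \<forall>y\<in>W. x + y \<in> V)"
proof -
  obtain V' where V': "openin T V'" "0 \<in> V'" "V' \<subseteq> V" using V unfolding zero_nbhd_def by blast
  have op: "openin (prod_topology T T) {z. (case z of (x, y) \<Rightarrow> x + y) \<in> V'}"
    using T openin_continuous_map_preimage[of "prod_topology T T" T "\<lambda>(x,y). x + y" V'] V'
    by (simp add: group_topology_def)
  have "(0, 0) \<in> {z. (case z of (x, y) \<Rightarrow> x + y) \<in> V'}" using V' by simp
  from iffD1[OF openin_prod_topology_alt op, rule_format, OF this]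
  obtain A B where AB: "openin T A" "openin T B" "0 \<in> A" "0 \<in> B"
     "A \<times> B \<subseteq> {z. (case z of (x, y) \<Rightarrow> x + y) \<in> V'}"
    by metis
  have "zero_nbhd T (A \<inter> B)" using AB by (simp add: zero_nbhd_open openin_Int)
  moreover have "\<forall>x\<in>A \<inter> B. \<forall>y\<in>A \<inter> B. x + y \<in> V" using AB V' by auto
  ultimately show ?thesis by blast
qed

lemma zero_nbhd_minus:
  assumes T: "group_topology T" and V: "zero_nbhd T V"
  shows "zero_nbhd T {x. - x \<in> V}"
proof -
  obtain V' where V': "openin T V'" "0 \<in> V'" "V' \<subseteq> V" using V unfolding zero_nbhd_def by blast
  have "openin T {x. - x \<in> V'}"
    using T openin_continuous_map_preimage[of T T uminus V'] V'
    by (simp add: group_topology_def)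
  then show ?thesis using V' unfolding zero_nbhd_def by (intro exI[of _ "{x. - x \<in> V'}"]) auto
qed

lemma zero_nbhd_diff:
  assumes T: "group_topology T" and V: "zero_nbhd T V"
  shows "\<exists>W. zero_nbhd T W \<and> (\<forall>x\<in>W. \<forall>y\<in>W. x - y \<in> V)"
proof -
  obtain W where W: "zero_nbhd T W" "\<And>x y. x \<in> W \<Longrightarrow> y \<in> W \<Longrightarrow> x + y \<in> V"
    using zero_nbhd_add[OF T V] by blast
  have "zero_nbhd T (W \<inter> {x. - x \<in> W})" using W(1) T by (simp add: zero_nbhd_Int zero_nbhd_minus)
  moreover have "\<forall>x\<in>W \<inter> {x. - x \<in> W}. \<forall>y\<in>W \<inter> {x. - x \<in> W}. x - y \<in> V"
    using W(2) by (metis IntE diff_conv_add_uminus mem_Collect_eq)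
  ultimately show ?thesis by blast
qed

lemma zero_nbhd_nat_mult:
  assumes T: "group_topology T"
  shows "zero_nbhd T V \<Longrightarrow> zero_nbhd T {x. nat_mult n x \<in> V}"
proof (induction n arbitrary: V)
  case 0
  then show ?case using zero_nbhd_mem[OF 0] zero_nbhd_UNIV[OF T] by simp
next
  case (Suc n)
  obtain W where W: "zero_nbhd T W" "\<And>x y. x \<in> W \<Longrightarrow> y \<in> W \<Longrightarrow> x + y \<in> V"
    using zero_nbhd_add[OF T Suc.prems] by blast
  have "zero_nbhd T (W \<inter> {x. nat_mult n x \<in> W})" using W(1) Suc.IH by (simp add: zero_nbhd_Int)
  then show ?case by (rule zero_nbhd_mono) (auto intro: W(2))
qed

lemma zero_nbhd_frac_set:
  assumes T: "group_topology T" and V: "zero_nbhd T V"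
  shows "zero_nbhd T (frac_set n V)"
proof (induction n)
  case 0
  then show ?case using zero_nbhd_UNIV[OF T] by (simp add: frac_set_def)
next
  case (Suc n)
  have "frac_set n V \<inter> {x. nat_mult (Suc n) x \<in> V} \<subseteq> frac_set (Suc n) V"
    by (auto simp: frac_set_def le_Suc_eq simp del: nat_mult.simps)
  then show ?case using Suc zero_nbhd_nat_mult[OF T V] by (meson zero_nbhd_Int zero_nbhd_mono)
qed

subsection \<open>Linear topologies\<close>

text \<open>A base at zero consisting of subgroups. Separation is left out on purpose: a single
  subgroup also counts, as needed in \<open>GTG_subset_subgrp\<close>.\<close>

definition lin_base :: "'a::ab_group_add set set \<Rightarrow> bool" where
  "lin_base \<B> \<longleftrightarrow> \<B> \<noteq> {} \<and> (\<forall>A\<in>\<B>. subgrp A) \<and> (\<forall>A\<in>\<B>. \<forall>B\<in>\<B>. \<exists>C\<in>\<B>. C \<subseteq> A \<inter> B)"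

definition lin_top :: "'a::ab_group_add set set \<Rightarrow> 'a topology" where
  "lin_top \<B> = topology (\<lambda>U. \<forall>x\<in>U. \<exists>B\<in>\<B>. \<forall>b\<in>B. x + b \<in> U)"

lemma openin_lin_top:
  assumes "lin_base \<B>"
  shows "openin (lin_top \<B>) U \<longleftrightarrow> (\<forall>x\<in>U. \<exists>B\<in>\<B>. \<forall>b\<in>B. x + b \<in> U)"
proof -
  have "istopology (\<lambda>U. \<forall>x\<in>U. \<exists>B\<in>\<B>. \<forall>b\<in>B. x + b \<in> U)"
    unfolding istopology_def
  proof (intro conjI allI impI ballI)
    fix U V x assume UV: "\<forall>x\<in>U. \<exists>B\<in>\<B>. \<forall>b\<in>B. x + b \<in> U" "\<forall>x\<in>V. \<exists>B\<in>\<B>. \<forall>b\<in>B. x + b \<in> V" "x \<in> U \<inter> V"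
    then obtain A B where AB: "A \<in> \<B>" "B \<in> \<B>" "\<forall>b\<in>A. x + b \<in> U" "\<forall>b\<in>B. x + b \<in> V" by blast
    then obtain C where "C \<in> \<B>" "C \<subseteq> A \<inter> B" using assms unfolding lin_base_def by metis
    then show "\<exists>B\<in>\<B>. \<forall>b\<in>B. x + b \<in> U \<inter> V" using AB by blast
  next
    fix \<K> x assume "\<forall>K\<in>\<K>. \<forall>x\<in>K. \<exists>B\<in>\<B>. \<forall>b\<in>B. x + b \<in> K" "x \<in> \<Union> \<K>"
    then show "\<exists>B\<in>\<B>. \<forall>b\<in>B. x + b \<in> \<Union> \<K>" by (meson UnionE UnionI)
  qed
  then show ?thesis by (simp add: lin_top_def)
qed

lemma topspace_lin_top: "lin_base \<B> \<Longrightarrow> topspace (lin_top \<B>) = UNIV"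
  using openin_lin_top[of \<B> UNIV] openin_subset[of "lin_top \<B>" UNIV] by (auto simp: lin_base_def)

lemma lin_base_coset:
  assumes "lin_base \<B>" "B \<in> \<B>"
  shows "openin (lin_top \<B>) {y. y - x \<in> B}"
  unfolding openin_lin_top[OF assms(1)]
proof (intro ballI bexI[OF _ assms(2)])
  fix y b assume "y \<in> {y. y - x \<in> B}" "b \<in> B"
  then have "(y - x) + b \<in> B" using assms unfolding lin_base_def by (blast intro: subgrp_add)
  then show "y + b \<in> {y. y - x \<in> B}" by (simp add: algebra_simps)
qed

lemma zero_nbhd_lin_top:
  assumes "lin_base \<B>"
  shows "zero_nbhd (lin_top \<B>) V \<longleftrightarrow> (\<exists>B\<in>\<B>. B \<subseteq> V)"
proof
  assume "zero_nbhd (lin_top \<B>) V"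
  then obtain W where "openin (lin_top \<B>) W" "0 \<in> W" "W \<subseteq> V" unfolding zero_nbhd_def by blast
  then obtain B where "B \<in> \<B>" "\<forall>b\<in>B. 0 + b \<in> W" using openin_lin_top[OF assms] by metis
  then show "\<exists>B\<in>\<B>. B \<subseteq> V" using \<open>W \<subseteq> V\<close> by auto
next
  assume "\<exists>B\<in>\<B>. B \<subseteq> V"
  then obtain B where B: "B \<in> \<B>" "B \<subseteq> V" by blast
  then have "openin (lin_top \<B>) B" using lin_base_coset[OF assms B(1), of 0] by simp
  moreover have "0 \<in> B" using B assms by (auto simp: lin_base_def intro: subgrp_zero)
  ultimately show "zero_nbhd (lin_top \<B>) V" using B unfolding zero_nbhd_def by blast
qed

lemma group_topology_lin_top:
  assumes L: "lin_base \<B>"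
  shows "group_topology (lin_top \<B>)"
proof -
  have sub: "subgrp B" if "B \<in> \<B>" for B using that L by (simp add: lin_base_def)
  note [simp] = topspace_lin_top[OF L]
  have 1: "continuous_map (prod_topology (lin_top \<B>) (lin_top \<B>)) (lin_top \<B>) (\<lambda>(x, y). x + y)"
    unfolding continuous_map_def
  proof (intro conjI allI impI)
    fix U assume U: "openin (lin_top \<B>) U"
    show "openin (prod_topology (lin_top \<B>) (lin_top \<B>))
      {x \<in> topspace (prod_topology (lin_top \<B>) (lin_top \<B>)). (case x of (x, y) \<Rightarrow> x + y) \<in> U}"
      unfolding openin_prod_topology_alt
    proof (intro allI impI)
      fix x y assume "(x, y) \<in> {x \<in> topspace (prod_topology (lin_top \<B>) (lin_top \<B>)). (case x of (x, y) \<Rightarrow> x + y) \<in> U}"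
      then obtain B where B: "B \<in> \<B>" "\<forall>b\<in>B. x + y + b \<in> U"
        using U unfolding openin_lin_top[OF L] by force
      have "x' + y' \<in> U" if "x' - x \<in> B" "y' - y \<in> B" for x' y'
      proof -
        have "x + y + ((x' - x) + (y' - y)) \<in> U" using B that sub by (blast intro: subgrp_add)
        then show ?thesis by (simp add: algebra_simps)
      qed
      then show "\<exists>Ua V. openin (lin_top \<B>) Ua \<and> openin (lin_top \<B>) V \<and> x \<in> Ua \<and> y \<in> V \<and>
           Ua \<times> V \<subseteq> {x \<in> topspace (prod_topology (lin_top \<B>) (lin_top \<B>)). (case x of (x, y) \<Rightarrow> x + y) \<in> U}"
        using lin_base_coset[OF L B(1)] sub[OF B(1)]
        by (intro exI[of _ "{z. z - x \<in> B}"] exI[of _ "{z. z - y \<in> B}"]) (auto simp: subgrp_zero)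
    qed
  qed auto
  have 2: "continuous_map (lin_top \<B>) (lin_top \<B>) uminus"
    unfolding continuous_map_def
  proof (intro conjI allI impI)
    fix U assume U: "openin (lin_top \<B>) U"
    show "openin (lin_top \<B>) {x \<in> topspace (lin_top \<B>). - x \<in> U}"
      unfolding openin_lin_top[OF L]
    proof (intro ballI)
      fix x assume "x \<in> {x \<in> topspace (lin_top \<B>). - x \<in> U}"
      then obtain B where B: "B \<in> \<B>" "\<forall>b\<in>B. - x + b \<in> U"
        using U unfolding openin_lin_top[OF L] by force
      then have "\<forall>b\<in>B. - x + - b \<in> U" using sub subgrp_minus by blast
      then show "\<exists>B\<in>\<B>. \<forall>b\<in>B. x + b \<in> {x \<in> topspace (lin_top \<B>). - x \<in> U}"
        using B by (intro bexI[of _ B]) auto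
    qed
  qed auto
  show ?thesis using 1 2 by (simp add: group_topology_def)
qed

lemma Hausdorff_lin_top:
  assumes L: "lin_base \<B>" and "\<Inter>\<B> \<subseteq> {0}"
  shows "Hausdorff_group_topology (lin_top \<B>)"
  unfolding Hausdorff_group_topology_def Hausdorff_space_def
proof (intro conjI allI impI)
  show "group_topology (lin_top \<B>)" using L by (rule group_topology_lin_top)
next
  fix x y assume "x \<in> topspace (lin_top \<B>) \<and> y \<in> topspace (lin_top \<B>) \<and> x \<noteq> y"
  then have "x - y \<notin> \<Inter>\<B>" using assms by auto
  then obtain B where B: "B \<in> \<B>" "x - y \<notin> B" by blast
  then have sub: "subgrp B" using L by (simp add: lin_base_def)
  have "disjnt {z. z - x \<in> B} {z. z - y \<in> B}"
  proof (clarsimp simp: disjnt_iff)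
    fix z assume "z - x \<in> B" "z - y \<in> B"
    from subgrp_diff[OF sub this(2,1)] show False using B by simp
  qed
  then show "\<exists>U V. openin (lin_top \<B>) U \<and> openin (lin_top \<B>) V \<and> x \<in> U \<and> y \<in> V \<and> disjnt U V"
    using lin_base_coset[OF L B(1)] sub
    by (intro exI[of _ "{z. z - x \<in> B}"] exI[of _ "{z. z - y \<in> B}"]) (auto simp: subgrp_zero)
qed

section \<open>Torsion and elements of prime order\<close>

lemma nat_mult_mod: "nat_mult n x = 0 \<Longrightarrow> nat_mult (k mod n) x = nat_mult k x"
  by (metis add_0 div_mult_mod_eq nat_mult_add nat_mult_mult nat_mult_zero)

lemma subgrp_sum: "subgrp H \<Longrightarrow> (\<And>i. i \<in> I \<Longrightarrow> f i \<in> H) \<Longrightarrow> sum f I \<in> H"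
  by (induction I rule: infinite_finite_induct) (auto intro: subgrp_zero subgrp_add)

text \<open>Descent on the exponent: for n = p m, either m already kills x, or m x is a nonzero
  element killed by p. Recording that p divides n leaves only finitely many primes to treat in
  \<open>ex_prime_open_torsion\<close>.\<close>

lemma ex_prime_torsion:
  assumes "nat_mult n x = 0" "x \<noteq> 0" "n \<ge> 1"
  shows "\<exists>p k. prime p \<and> p dvd n \<and> nat_mult k x \<noteq> 0 \<and> nat_mult p (nat_mult k x) = 0"
  using assms
proof (induction n rule: less_induct)
  case (less n)
  have "n \<noteq> 1" using less.prems by auto
  then obtain p where p: "prime p" "p dvd n" using prime_factor_nat by blast
  then obtain m where m: "n = p * m" by blast
  show ?case
  proof (cases "nat_mult m x = 0")
    case True
    have "m \<noteq> 0" using less.prems(3) m by (metis mult_0_right not_one_le_zero)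
    then have "m < n" using m prime_gt_1_nat[OF p(1)] by simp
    moreover have "m \<ge> 1" using \<open>m \<noteq> 0\<close> by simp
    ultimately show ?thesis using less.IH[of m] True less.prems(2) m by (metis dvd_mult)
  next
    case False
    then show ?thesis using p m less.prems by (metis nat_mult_mult)
  qed
qed

subsection \<open>Locally minimal linear topologies\<close>

text \<open>In any group topology, Hausdorff or not, a neighbourhood of zero contained in all others
  is closed under differences.\<close>

lemma subgrp_frac_set:
  assumes U: "GTG_subset U" and n: "n \<ge> 1" "\<And>x::'a::ab_group_add. nat_mult n x = 0"
  shows "subgrp (frac_set n U :: 'a set)"
proof -
  obtain S where S: "group_topology S" "\<And>k. k \<ge> 1 \<Longrightarrow> zero_nbhd S (frac_set k U)"
    "\<And>V. zero_nbhd S V \<Longrightarrow> \<exists>k\<ge>1. frac_set k U \<subseteq> V"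
    using U unfolding GTG_subset_def by blast
  have U0: "0 \<in> U" using U by (simp add: GTG_subset_def)
  have least: "frac_set n U \<subseteq> frac_set k U" for k
  proof
    fix x assume x: "x \<in> frac_set n U"
    \<comment> \<open>Multiples depend only on j mod n; residue 0 lies outside {1..n} and is covered
      by 0 \<in> U.\<close>
    have "nat_mult j x \<in> U" for j
    proof (cases "j mod n = 0")
      case True
      then show ?thesis using nat_mult_mod[OF n(2), of j x] U0 by simp
    next
      case False
      then have "j mod n \<in> {1..n}" using n(1) by (simp add: order_less_imp_le)
      then have "nat_mult (j mod n) x \<in> U" using x unfolding frac_set_def by blast
      then show ?thesis using nat_mult_mod[OF n(2), of j x] by simp
    qed
    then show "x \<in> frac_set k U" by (simp add: frac_set_def)
  qed
  obtain W where W: "zero_nbhd S W" "\<forall>x\<in>W. \<forall>y\<in>W. x - y \<in> frac_set n U"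
    using zero_nbhd_diff[OF S(1) S(2)[OF n(1)]] by blast
  have "frac_set n U \<subseteq> W" using S(3)[OF W(1)] least by blast
  then show ?thesis
    unfolding subgrp_def using W(2) zero_nbhd_mem[OF S(2)[OF n(1)]] by blast
qed

text \<open>The topology behind the GTG property of U is unrelated to T. That (1/n)U is a
  neighbourhood for T follows instead from the continuity of the first n multiplication maps,
  because U is one.\<close>

lemma locally_GTG_subgrp:
  assumes T: "locally_GTG T" and V: "zero_nbhd T V"
    and n: "n \<ge> 1" "\<And>x::'a::ab_group_add. nat_mult n x = 0"
  shows "\<exists>H::'a set. subgrp H \<and> zero_nbhd T H \<and> H \<subseteq> V"
proof -
  obtain W where W: "openin T W" "0 \<in> W" "W \<subseteq> V" using V unfolding zero_nbhd_def by blast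
  then obtain U0 U where U: "openin T U0" "GTG_subset U" "0 \<in> U0" "U0 \<subseteq> U" "U \<subseteq> W"
    using T unfolding locally_GTG_def neighbourhood_base_at_def by blast
  have T': "group_topology T" using T by (simp add: locally_GTG_def Hausdorff_group_topology_def)
  have "zero_nbhd T U" using U unfolding zero_nbhd_def by blast
  moreover have "frac_set n U \<subseteq> U"
    using n(1) unfolding frac_set_def by (force dest: bspec[of _ _ "Suc 0"])
  ultimately show ?thesis
    using subgrp_frac_set[OF U(2) n] zero_nbhd_frac_set[OF T'] U W by blast
qed

text \<open>The topology \<open>lin_top \<B>\<close> is a competitor in the definition of local
  minimality, so it equals T; reading the equality at zero makes \<open>\<B>\<close>
  cofinal.\<close>

lemma locally_minimal_lin_base:
  assumes "\<And>S. Hausdorff_group_topology S \<Longrightarrow> coarser S T \<Longrightarrow> zero_nbhd S V \<Longrightarrow> S = T"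
    and T: "group_topology T" and L: "lin_base \<B>" "\<Inter>\<B> \<subseteq> {0}"
    and open\<B>: "\<And>B. B \<in> \<B> \<Longrightarrow> zero_nbhd T B" and B: "B \<in> \<B>" "B \<subseteq> V" and N: "zero_nbhd T N"
  shows "\<exists>B\<in>\<B>. B \<subseteq> N"
proof -
  have "coarser (lin_top \<B>) T"
    using coarser_if_zero_nbhd group_topology_lin_top[OF L(1)] T open\<B> zero_nbhd_lin_top[OF L(1)]
      zero_nbhd_mono by metis
  moreover have "zero_nbhd (lin_top \<B>) V" using B zero_nbhd_lin_top[OF L(1)] by blast
  ultimately have "lin_top \<B> = T" using assms(1) Hausdorff_lin_top[OF L] by blast
  then show ?thesis using zero_nbhd_lin_top[OF L(1)] N by blast
qed

text \<open>S is a subset rather than a type, so its topology is represented by the family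
  \<open>Opn\<close> of its open subgroups. The assumption \<open>minimal\<close> says that no
  Hausdorff linear topology on S is strictly coarser.\<close>

locale minimal_linear =
  fixes p :: nat and S :: "'a::ab_group_add set" and Opn :: "'a set \<Rightarrow> bool"
  assumes prime: "prime p" and subgrp_S: "subgrp S"
    and torsion: "x \<in> S \<Longrightarrow> nat_mult p x = 0"
    and Opn_subgrp: "Opn A \<Longrightarrow> subgrp A" and Opn_subset: "Opn A \<Longrightarrow> A \<subseteq> S"
    and Opn_S: "Opn S" and Opn_Int: "Opn A \<Longrightarrow> Opn B \<Longrightarrow> Opn (A \<inter> B)"
    and Opn_mono: "Opn A \<Longrightarrow> subgrp B \<Longrightarrow> A \<subseteq> B \<Longrightarrow> B \<subseteq> S \<Longrightarrow> Opn B"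
    and separated: "x \<in> S \<Longrightarrow> x \<noteq> 0 \<Longrightarrow> \<exists>A. Opn A \<and> x \<notin> A"
    and nondiscrete: "\<not> Opn {0}"
    and minimal: "lin_base \<B> \<Longrightarrow> (\<And>B. B \<in> \<B> \<Longrightarrow> Opn B) \<Longrightarrow> \<Inter>\<B> \<subseteq> {0} \<Longrightarrow> Opn A \<Longrightarrow> \<exists>B\<in>\<B>. B \<subseteq> A"
begin

section \<open>Open hyperplanes and finite index\<close>

lemma p_ge_1: "p \<ge> 1"
  using prime_ge_1_nat[OF prime] .

lemma subgrp_adj_S: "subgrp A \<Longrightarrow> y \<in> S \<Longrightarrow> subgrp (adj A y)"
  using subgrp_adj[OF _ p_ge_1] torsion subgrp_zero by metis

lemma Opn_adj: "Opn A \<Longrightarrow> y \<in> S \<Longrightarrow> Opn (adj A y)"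
  by (meson Opn_mono Opn_subgrp Opn_subset adj_subset adj_subset_subgrp subgrp_S subgrp_adj_S)

text \<open>M is maximal among the subgroups of S that contain an open A and miss s. For x outside
  M, maximality puts s into M + <x>, and exchange turns this into x \<in> M + <s>. M is open because
  it contains A.\<close>

lemma ex_hyperplane:
  assumes s: "s \<in> S" "s \<noteq> 0"
  shows "\<exists>M. Opn M \<and> s \<notin> M \<and> S \<subseteq> adj M s"
proof -
  obtain A where A: "Opn A" "s \<notin> A" using separated s by blast
  let ?\<A> = "{B. subgrp B \<and> A \<subseteq> B \<and> B \<subseteq> S \<and> s \<notin> B}"
  have "\<exists>M\<in>?\<A>. \<forall>X\<in>?\<A>. M \<subseteq> X \<longrightarrow> X = M"
  proof (rule subset_Zorn_nonempty)
    have "A \<in> ?\<A>" using A by (simp add: Opn_subgrp Opn_subset)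
    then show "?\<A> \<noteq> {}" by blast
  next
    fix C assume C: "C \<noteq> {}" "subset.chain ?\<A> C"
    then have "subset.chain {H. subgrp H} C" by (auto simp: subset_chain_def)
    then have "subgrp (\<Union>C)" using C subgrp_Union_chain by blast
    then show "\<Union>C \<in> ?\<A>" using C by (auto simp: subset_chain_def)
  qed
  then obtain M where "M \<in> ?\<A>" and max: "\<forall>X\<in>?\<A>. M \<subseteq> X \<longrightarrow> X = M" by (rule bexE)
  then have M: "subgrp M" "A \<subseteq> M" "M \<subseteq> S" "s \<notin> M" by simp_all
  have "x \<in> adj M s" if x: "x \<in> S" for x
  proof (cases "x \<in> M")
    case True
    then show ?thesis using adj_subset by blast
  next
    case False
    then have "adj M x \<noteq> M" using adj_self[OF M(1)] by metis
    then have "adj M x \<notin> ?\<A>" using max adj_subset by metis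
    then have "s \<in> adj M x"
      using M x subgrp_adj_S adj_subset[of M x] adj_subset_subgrp[OF subgrp_S] by auto
    then show ?thesis
      using adj_exchange[OF M(1) prime] torsion[OF x] M(1,4) subgrp_zero by metis
  qed
  moreover have "Opn M" using Opn_mono A M by blast
  ultimately show ?thesis using M by blast
qed

text \<open>g colours S with finitely many numbers so that each colour stays inside one coset of A.
  No quotient is formed, and intersections are handled by pairing colours.\<close>

definition finite_index :: "'a set \<Rightarrow> bool" where
  "finite_index A \<longleftrightarrow> (\<exists>g :: 'a \<Rightarrow> nat. finite (g ` S) \<and> (\<forall>x\<in>S. \<forall>y\<in>S. g x = g y \<longrightarrow> x - y \<in> A))"

lemma finite_index_Int:
  assumes "finite_index A" "finite_index B"
  shows "finite_index (A \<inter> B)"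
proof -
  obtain g h :: "'a \<Rightarrow> nat" where g: "finite (g ` S)" "\<forall>x\<in>S. \<forall>y\<in>S. g x = g y \<longrightarrow> x - y \<in> A"
    and h: "finite (h ` S)" "\<forall>x\<in>S. \<forall>y\<in>S. h x = h y \<longrightarrow> x - y \<in> B"
    using assms unfolding finite_index_def by metis
  have "(\<lambda>x. prod_encode (g x, h x)) ` S \<subseteq> prod_encode ` (g ` S \<times> h ` S)" by blast
  then have "finite ((\<lambda>x. prod_encode (g x, h x)) ` S)" by (rule finite_subset) (use g(1) h(1) in simp)
  then show ?thesis
    unfolding finite_index_def using g h by (intro exI[of _ "\<lambda>x. prod_encode (g x, h x)"]) auto
qed

text \<open>The coefficient of s matters only modulo p, so the coefficient below p serves as a
  colour.\<close>

lemma finite_index_adj: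
  assumes M: "subgrp M" "s \<in> S" "S \<subseteq> adj M s"
  shows "finite_index M"
proof -
  have "\<exists>k<p. x - nat_mult k s \<in> M" if "x \<in> S" for x
  proof -
    obtain k where "x - nat_mult k s \<in> M" using M \<open>x \<in> S\<close> by (auto simp: adj_def)
    then have "x - nat_mult (k mod p) s \<in> M" using nat_mult_mod[OF torsion[OF M(2)]] by simp
    then show ?thesis using p_ge_1 by (intro exI[of _ "k mod p"]) auto
  qed
  then obtain g where g: "\<And>x. x \<in> S \<Longrightarrow> g x < p \<and> x - nat_mult (g x) s \<in> M" by metis
  have "g ` S \<subseteq> {..<p}" using g by auto
  moreover have "x - y \<in> M" if "x \<in> S" "y \<in> S" "g x = g y" for x y
  proof -
    have "(x - nat_mult (g x) s) - (y - nat_mult (g y) s) \<in> M"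
      using subgrp_diff[OF M(1)] g that(1,2) by blast
    then show ?thesis using that by simp
  qed
  ultimately show ?thesis unfolding finite_index_def by (meson finite_lessThan finite_subset)
qed

text \<open>The open subgroups of finite index form a linear base, and it separates points because
  hyperplanes belong to it. By minimality every open A contains one of them, and finite index passes
  to larger subgroups.\<close>

lemma finite_index_Opn:
  assumes "Opn A"
  shows "finite_index A"
proof -
  let ?\<B> = "{A. Opn A \<and> finite_index A}"
  have "finite ((\<lambda>_. 0 :: nat) ` S)" by (rule finite_subset[of _ "{0}"]) auto
  then have "finite_index S"
    unfolding finite_index_def using subgrp_diff[OF subgrp_S] by blast
  then have S: "S \<in> ?\<B>" using Opn_S by blast
  have "lin_base ?\<B>"
    unfolding lin_base_def
  proof (intro conjI ballI)
    fix A B assume "A \<in> ?\<B>" "B \<in> ?\<B>"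
    then have "A \<inter> B \<in> ?\<B>" by (simp add: Opn_Int finite_index_Int)
    then show "\<exists>C\<in>?\<B>. C \<subseteq> A \<inter> B" by blast
  qed (use S Opn_subgrp in auto)
  moreover have "\<Inter>?\<B> \<subseteq> {0}"
  proof
    fix s assume s: "s \<in> \<Inter>?\<B>"
    then have "s \<in> S" using S by blast
    show "s \<in> {0}"
    proof (rule ccontr)
      assume "s \<notin> {0}"
      then obtain M where "Opn M" "s \<notin> M" "S \<subseteq> adj M s" using ex_hyperplane \<open>s \<in> S\<close> by blast
      then show False using finite_index_adj[OF Opn_subgrp \<open>s \<in> S\<close>] s by blast
    qed
  qed
  ultimately obtain B where "B \<in> ?\<B>" "B \<subseteq> A" using minimal assms by (metis (no_types, lifting) mem_Collect_eq)
  then show ?thesis unfolding finite_index_def by blast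
qed

text \<open>A pair \<open>(y, A)\<close> stands for the coset \<open>y + A\<close>.\<close>

definition cosets :: "('a \<times> 'a set) set" where
  "cosets = {(y, A). y \<in> S \<and> Opn A}"

definition fip :: "('a \<times> 'a set) set \<Rightarrow> bool" where
  "fip F \<longleftrightarrow> (\<forall>F'\<subseteq>F. finite F' \<longrightarrow> (\<exists>x\<in>S. \<forall>(y, A)\<in>F'. x - y \<in> A))"

lemma ex_maximal_fip:
  assumes "F0 \<subseteq> cosets" "fip F0"
  shows "\<exists>F. F0 \<subseteq> F \<and> F \<subseteq> cosets \<and> fip F \<and> (\<forall>q\<in>cosets. fip (insert q F) \<longrightarrow> q \<in> F)"
proof -
  let ?\<A> = "{F. F0 \<subseteq> F \<and> F \<subseteq> cosets \<and> fip F}"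
  have "\<exists>M\<in>?\<A>. \<forall>X\<in>?\<A>. M \<subseteq> X \<longrightarrow> X = M"
  proof (rule subset_Zorn_nonempty)
    show "?\<A> \<noteq> {}" using assms by blast
  next
    fix C assume C: "C \<noteq> {}" "subset.chain ?\<A> C"
    have "fip (\<Union>C)"
      unfolding fip_def
    proof (intro allI impI)
      fix F' assume "F' \<subseteq> \<Union>C" "finite F'"
      then obtain X where X: "X \<in> C" "F' \<subseteq> X"
        using finite_subset_Union_chain[of F' C] C by blast
      then have "fip X" using C by (auto simp: subset_chain_def)
      then show "\<exists>x\<in>S. \<forall>(y, A)\<in>F'. x - y \<in> A"
        using X \<open>finite F'\<close> unfolding fip_def by blast
    qed
    then show "\<Union>C \<in> ?\<A>" using C by (auto simp: subset_chain_def)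
  qed
  then obtain F where "F \<in> ?\<A>" and max: "\<forall>X\<in>?\<A>. F \<subseteq> X \<longrightarrow> X = F" by (rule bexE)
  then have F: "F0 \<subseteq> F" "F \<subseteq> cosets" "fip F" by simp_all
  have "q \<in> F" if "q \<in> cosets" "fip (insert q F)" for q
  proof -
    have "insert q F \<in> ?\<A>" using that F by auto
    then have "insert q F = F" using max by blast
    then show ?thesis by blast
  qed
  then show ?thesis using F by blast
qed

text \<open>Finitely many cosets of A cover S. If none were in F, each would be refuted by a finite
  part of F; but a point common to all these parts still lies in one of the cosets.\<close>

lemma maximal_fip_meets:
  assumes F: "fip F" "\<forall>q\<in>cosets. fip (insert q F) \<longrightarrow> q \<in> F" and A: "Opn A"
  shows "\<exists>y. (y, A) \<in> F"
proof (rule ccontr)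
  assume no: "\<nexists>y. (y, A) \<in> F"
  obtain g :: "'a \<Rightarrow> nat" where g: "finite (g ` S)" "\<And>x y. x \<in> S \<Longrightarrow> y \<in> S \<Longrightarrow> g x = g y \<Longrightarrow> x - y \<in> A"
    using finite_index_Opn[OF A] unfolding finite_index_def by blast
  have "\<exists>F'\<subseteq>F. finite F' \<and> (\<forall>x\<in>S. (\<forall>(z, B)\<in>F'. x - z \<in> B) \<longrightarrow> x - y \<notin> A)" if "y \<in> S" for y
  proof -
    have "\<not> fip (insert (y, A) F)" using F(2) no A that by (auto simp: cosets_def)
    then obtain F' where F': "F' \<subseteq> insert (y, A) F" "finite F'" "\<not> (\<exists>x\<in>S. \<forall>(y, A)\<in>F'. x - y \<in> A)"
      unfolding fip_def by blast
    have "x - y \<notin> A" if x: "x \<in> S" "\<forall>(z, B)\<in>F' - {(y, A)}. x - z \<in> B" for x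
    proof
      assume "x - y \<in> A"
      then have "\<forall>(z, B)\<in>F'. x - z \<in> B" using x(2) by blast
      then show False using F'(3) x(1) by blast
    qed
    then show ?thesis using F' by (intro exI[of _ "F' - {(y, A)}"]) auto
  qed
  then obtain G where G: "\<And>y. y \<in> S \<Longrightarrow> G y \<subseteq> F \<and> finite (G y) \<and>
      (\<forall>x\<in>S. (\<forall>(z, B)\<in>G y. x - z \<in> B) \<longrightarrow> x - y \<notin> A)"
    by metis
  \<comment> \<open>One representative per colour suffices: x and \<open>?r (g x)\<close> differ by
    an element of A.\<close>
  let ?r = "inv_into S g"
  have r: "?r v \<in> S" "g (?r v) = v" if "v \<in> g ` S" for v
    using that by (auto simp: inv_into_into f_inv_into_f)
  have "(\<Union>v\<in>g ` S. G (?r v)) \<subseteq> F" "finite (\<Union>v\<in>g ` S. G (?r v))"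
    using G r g(1) by (blast, intro finite_UN_I) auto
  then obtain x where x: "x \<in> S" "\<forall>(z, B)\<in>(\<Union>v\<in>g ` S. G (?r v)). x - z \<in> B"
    using F(1) unfolding fip_def by metis
  have "\<forall>(z, B)\<in>G (?r (g x)). x - z \<in> B" using x by blast
  then have "x - ?r (g x) \<notin> A" using G[OF r(1)] x by blast
  then show False using g(2)[of x "?r (g x)"] r x by auto
qed

text \<open>A limit point \<open>z\<close> of \<open>F\<close> in the completion that lies outside \<open>S\<close> could be divided out: the
  subgroups \<open>A + \<langle>y\<rangle>\<close> with \<open>y + A\<close> in \<open>F\<close> are the traces of the neighbourhoods of \<open>\<langle>z\<rangle>\<close>, and they
  would define a strictly coarser Hausdorff topology.\<close>

lemma maximal_fip_converges:
  assumes F: "F \<subseteq> cosets" "fip F" "\<forall>q\<in>cosets. fip (insert q F) \<longrightarrow> q \<in> F"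
  shows "\<exists>z\<in>S. \<forall>(y, A)\<in>F. z - y \<in> A"
proof (rule ccontr)
  assume no: "\<not> (\<exists>z\<in>S. \<forall>(y, A)\<in>F. z - y \<in> A)"
  have FD: "y \<in> S" "Opn A" "subgrp A" if "(y, A) \<in> F" for y A
    using that F(1) Opn_subgrp by (auto simp: cosets_def)
  have common: "\<exists>x\<in>S. x - y \<in> A \<and> x - z \<in> B" if "(y, A) \<in> F" "(z, B) \<in> F" for y A z B
    using F(2)[unfolded fip_def, rule_format, of "{(y, A), (z, B)}"] that by auto
  \<comment> \<open>Two cosets from F always meet, so the finer one lies inside the coarser
    one.\<close>
  have close: "z - y \<in> A" if yz: "(y, A) \<in> F" "(z, B) \<in> F" "B \<subseteq> A" for y z A B
  proof -
    obtain x where "x - y \<in> A" "x - z \<in> A" using common yz by blast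
    then have "(x - y) - (x - z) \<in> A" using FD yz by (blast intro: subgrp_diff)
    then show ?thesis by simp
  qed
  have close_mult: "x - nat_mult k y \<in> A"
    if "(y, A) \<in> F" "(z, B) \<in> F" "B \<subseteq> A" "x - nat_mult k z \<in> A" for x k y z A B
  proof -
    have "(x - nat_mult k z) + nat_mult k (z - y) \<in> A"
      using that FD(3)[OF that(1)] close[OF that(1-3)] by (metis subgrp_add subgrp_mult)
    then show ?thesis by (simp add: nat_mult_diff)
  qed
  let ?\<B> = "(\<lambda>(y, A). adj A y) ` F"
  have meets: "\<exists>y. (y, A) \<in> F" if "Opn A" for A using maximal_fip_meets F that by blast
  have Opn\<B>: "Opn B" if "B \<in> ?\<B>" for B using that Opn_adj FD by auto
  have L: "lin_base ?\<B>"
    unfolding lin_base_def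
  proof (intro conjI ballI)
    show "?\<B> \<noteq> {}" using meets[OF Opn_S] by auto
  next
    fix B assume "B \<in> ?\<B>"
    then show "subgrp B" using Opn\<B> Opn_subgrp by blast
  next
    fix B1 B2 assume "B1 \<in> ?\<B>" "B2 \<in> ?\<B>"
    then obtain y1 A1 y2 A2 where B: "(y1, A1) \<in> F" "(y2, A2) \<in> F" "B1 = adj A1 y1" "B2 = adj A2 y2"
      by auto
    then obtain y where y: "(y, A1 \<inter> A2) \<in> F" using meets Opn_Int FD by meson
    have "adj (A1 \<inter> A2) y \<subseteq> B1 \<inter> B2"
      unfolding B adj_def using close_mult[OF B(1) y] close_mult[OF B(2) y] by blast
    then show "\<exists>C\<in>?\<B>. C \<subseteq> B1 \<inter> B2" using y by (force intro: rev_bexI)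
  qed
  have I: "\<Inter>?\<B> \<subseteq> {0}"
  proof
    fix s assume s: "s \<in> \<Inter>?\<B>"
    obtain y where y: "(y, S) \<in> F" using meets[OF Opn_S] by blast
    then have "s \<in> adj S y" using s by auto
    then have sS: "s \<in> S" using adj_subset_subgrp[OF subgrp_S order_refl] FD y by blast
    show "s \<in> {0}"
    proof (rule ccontr)
      assume "s \<notin> {0}"
      then obtain A0 where A0: "Opn A0" "s \<notin> A0" using separated sS by blast
      then obtain y0 where y0: "(y0, A0) \<in> F" using meets by blast
      have sub0: "subgrp A0" using A0 Opn_subgrp by blast
      have "s \<in> adj A0 y0" using s y0 by auto
      then obtain k where k: "s - nat_mult k y0 \<in> A0" by (auto simp: adj_def)
      \<comment> \<open>Modulo A0 the element y0 has order exactly p, because s is a multiple of it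
        there and does not vanish.\<close>
      have y0A0: "y0 \<notin> A0"
        using k A0(2) sub0 by (metis diff_add_cancel subgrp_add subgrp_mult)
      have pk: "\<not> p dvd k"
      proof
        assume "p dvd k"
        then have "nat_mult k y0 = 0" using nat_mult_dvd torsion FD y0 by metis
        then show False using k A0 by simp
      qed
      \<comment> \<open>One coefficient k serves all cosets: on the refinement by A \<inter> A0 some
        coefficient j works, and reduction modulo A0, where y0 has order p, forces j and k to agree
        modulo p.\<close>
      have all: "s - nat_mult k y \<in> A" if yA: "(y, A) \<in> F" for y A
      proof -
        obtain z where z: "(z, A \<inter> A0) \<in> F" using meets Opn_Int FD[OF yA] A0 by meson
        then have "s \<in> adj (A \<inter> A0) z" using s by force
        then obtain j where j: "s - nat_mult j z \<in> A \<inter> A0" by (auto simp: adj_def)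
        then have 1: "s - nat_mult j y \<in> A" "s - nat_mult j y0 \<in> A0"
          using close_mult[OF yA z, of s j] close_mult[OF y0 z, of s j] by auto
        have mod: "nat_mult (j mod p) w = nat_mult (k mod p) w \<longleftrightarrow> nat_mult j w = nat_mult k w" if "w \<in> S" for w
          using torsion[OF that] by (simp add: nat_mult_mod)
        have "j mod p = k mod p"
        proof (rule ccontr)
          assume ne: "j mod p \<noteq> k mod p"
          have d: "nat_mult j y0 - nat_mult k y0 \<in> A0" "nat_mult k y0 - nat_mult j y0 \<in> A0"
            using subgrp_diff[OF sub0 k 1(2)] subgrp_diff[OF sub0 1(2) k] by auto
          have p0: "nat_mult p y0 \<in> A0" using torsion FD y0 sub0 subgrp_zero by metis
          show False
          proof (cases "k \<le> j")
            case True
            then have "nat_mult (j - k) y0 \<in> A0" using d(1) nat_mult_add[of "j - k" k y0] by simp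
            moreover have "\<not> p dvd (j - k)" using ne True by (metis mod_eq_dvd_iff_nat)
            ultimately show False using mem_if_prime_mult[OF sub0 prime p0] y0A0 by blast
          next
            case False
            then have "nat_mult (k - j) y0 \<in> A0" using d(2) nat_mult_add[of "k - j" j y0] by simp
            moreover have "\<not> p dvd (k - j)" using ne False by (metis mod_eq_dvd_iff_nat nat_le_linear)
            ultimately show False using mem_if_prime_mult[OF sub0 prime p0] y0A0 by blast
          qed
        qed
        then show ?thesis using 1 mod[OF FD(1)[OF yA]] by simp
      qed
      \<comment> \<open>With l inverse to k modulo p, the element l s of S is a limit of F, contrary
        to \<open>no\<close>.\<close>
      obtain l m where lm: "k * l = p * m + 1" using prime_inverse[OF prime pk] by blast
      have "nat_mult l s - y \<in> A" if yA: "(y, A) \<in> F" for y A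
      proof -
        have "nat_mult (l * k) y = nat_mult (m * p + 1) y" using lm by (simp add: mult.commute)
        then have "nat_mult l (nat_mult k y) = y"
          using torsion[OF FD(1)[OF yA]] by (simp add: nat_mult_mult nat_mult_add)
        then show ?thesis
          using subgrp_mult[OF FD(3)[OF yA] all[OF yA], of l] by (simp add: nat_mult_diff)
      qed
      then show False using no subgrp_mult[OF subgrp_S sS, of l] by blast
    qed
  qed
  \<comment> \<open>As 0 is not a limit, some coset y + A in F misses 0. Minimality puts one of the
    subgroups B + <z> inside A, and then closeness of z to y forces y \<in> A.\<close>
  obtain y A where yA: "(y, A) \<in> F" "0 - y \<notin> A" using no subgrp_zero[OF subgrp_S] by blast
  then have "y \<notin> A" using FD subgrp_minus by fastforce
  obtain z B where zB: "(z, B) \<in> F" "adj B z \<subseteq> A"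
    using minimal[OF L Opn\<B> I FD(2)[OF yA(1)]] by auto
  then have "z \<in> A" "B \<subseteq> A" using adj_self FD adj_subset by blast+
  then have "z - (z - y) \<in> A" using close[OF yA(1) zB(1)] FD(3)[OF yA(1)] subgrp_diff by blast
  then show False using \<open>y \<notin> A\<close> by simp
qed

lemma fip_converges:
  assumes "F \<subseteq> cosets" "fip F"
  shows "\<exists>z\<in>S. \<forall>(y, A)\<in>F. z - y \<in> A"
proof -
  obtain F' where "F \<subseteq> F'" "F' \<subseteq> cosets" "fip F'" "\<forall>q\<in>cosets. fip (insert q F') \<longrightarrow> q \<in> F'"
    using ex_maximal_fip[OF assms] by blast
  then show ?thesis using maximal_fip_converges[of F'] by blast
qed

text \<open>A Cantor scheme of convergent series: with x i in N i but not in N (i+1), each set A of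
  indices gives a sum of the x i over A, which exists by completeness. At the first index n where
  two sets differ, their sums are distinct modulo N (n+1).\<close>

theorem continuum_lepoll: "(UNIV :: nat set set) \<lesssim> S"
proof -
  \<comment> \<open>Each chosen element is nonzero, so some open subgroup misses it; nondiscreteness
    supplies a nonzero element of the smaller subgroup.\<close>
  have step: "\<exists>q. Opn (fst q) \<and> snd q \<in> fst q \<and> snd q \<noteq> 0 \<and> fst q \<subseteq> A \<and> x \<notin> fst q"
    if A: "Opn A" "x \<in> A" "x \<noteq> 0" for A x
  proof -
    obtain B where "Opn B" "x \<notin> B" using separated A Opn_subset by blast
    then have B: "Opn (A \<inter> B)" using A Opn_Int by blast
    then have "A \<inter> B \<noteq> {0}" using nondiscrete by metis
    then obtain y where "y \<in> A \<inter> B" "y \<noteq> 0" using subgrp_zero[OF Opn_subgrp[OF B]] by blast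
    then show ?thesis using B \<open>x \<notin> B\<close> by (intro exI[of _ "(A \<inter> B, y)"]) auto
  qed
  have "S \<noteq> {0}" using nondiscrete Opn_S by metis
  then have "\<exists>x\<in>S. x \<noteq> 0" using subgrp_zero[OF subgrp_S] by blast
  then have start: "\<exists>q. Opn (fst q) \<and> snd q \<in> fst q \<and> snd q \<noteq> 0" using Opn_S by auto
  obtain f where f: "\<And>n. Opn (fst (f n)) \<and> snd (f n) \<in> fst (f n) \<and> snd (f n) \<noteq> 0"
    "\<And>n. fst (f (Suc n)) \<subseteq> fst (f n) \<and> snd (f n) \<notin> fst (f (Suc n))"
    using dependent_nat_choice[of "\<lambda>_ q. Opn (fst q) \<and> snd q \<in> fst q \<and> snd q \<noteq> 0"
        "\<lambda>_ q q'. fst q' \<subseteq> fst q \<and> snd q \<notin> fst q'"] start step by (smt (verit, best))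
  define N where "N = (\<lambda>n. fst (f n))"
  define x where "x = (\<lambda>n. snd (f n))"
  have N: "Opn (N n)" "x n \<in> N n" "N (Suc n) \<subseteq> N n" "x n \<notin> N (Suc n)" for n
    using f unfolding N_def x_def by auto
  have sub: "subgrp (N n)" for n using N Opn_subgrp by blast
  have anti: "N m \<subseteq> N n" if "n \<le> m" for n m using that N(3) by (rule lift_Suc_antimono_le[rotated])
  define y where "y = (\<lambda>A n. \<Sum>i\<in>A \<inter> {..<n}. x i)"
  have y_diff: "y A m - y A n \<in> N n" if "n \<le> m" for A n m
  proof -
    have "A \<inter> {..<m} = (A \<inter> {..<n}) \<union> (A \<inter> {n..<m})" using that by auto
    moreover have "(A \<inter> {..<n}) \<inter> (A \<inter> {n..<m}) = {}" by auto
    ultimately have "y A m = y A n + (\<Sum>i\<in>A \<inter> {n..<m}. x i)"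
      unfolding y_def by (simp add: sum.union_disjoint)
    moreover have "(\<Sum>i\<in>A \<inter> {n..<m}. x i) \<in> N n"
      using N(2) anti by (intro subgrp_sum sub) auto
    ultimately show ?thesis by simp
  qed
  have yS: "y A n \<in> S" for A n
    unfolding y_def using N Opn_subset by (intro subgrp_sum subgrp_S) blast
  have "\<exists>z\<in>S. \<forall>n. z - y A n \<in> N n" for A
  proof -
    let ?F = "range (\<lambda>n. (y A n, N n))"
    have "fip ?F"
      unfolding fip_def
    proof (intro allI impI)
      fix F' assume "F' \<subseteq> ?F" "finite F'"
      then obtain I where I: "finite I" "F' = (\<lambda>n. (y A n, N n)) ` I"
        by (meson finite_subset_image)
      then obtain m where "\<forall>n\<in>I. n \<le> m" using finite_nat_set_iff_bounded_le by blast
      then show "\<exists>x\<in>S. \<forall>(y, A)\<in>F'. x - y \<in> A" using I y_diff yS by (intro bexI[of _ "y A m"]) auto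
    qed
    moreover have "?F \<subseteq> cosets" using yS N by (auto simp: cosets_def)
    ultimately show ?thesis using fip_converges[of ?F] by auto
  qed
  then obtain z where z: "\<And>A. z A \<in> S" "\<And>A n. z A - y A n \<in> N n" by metis
  have "inj z"
  proof (rule injI, rule ccontr)
    fix A B assume eq: "z A = z B" and "A \<noteq> B"
    then have "\<exists>n. (n \<in> A) \<noteq> (n \<in> B)" by blast
    then obtain n where n: "(n \<in> A) \<noteq> (n \<in> B)" "\<And>i. i < n \<Longrightarrow> (i \<in> A) = (i \<in> B)"
      using exists_least_iff[of "\<lambda>n. (n \<in> A) \<noteq> (n \<in> B)"] by blast
    have "A \<inter> {..<n} = B \<inter> {..<n}" using n by auto
    then have yn: "y A n = y B n" by (simp add: y_def)
    have ySuc: "y C (Suc n) = (if n \<in> C then x n else 0) + y C n" for C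
      unfolding y_def by (auto simp: lessThan_Suc)
    \<comment> \<open>Everything cancels except x n up to sign; the two orders of subtraction cover
      the cases n \<in> A and n \<in> B.\<close>
    have "(z A - y A (Suc n)) - (z B - y B (Suc n)) \<in> N (Suc n)"
      "(z B - y B (Suc n)) - (z A - y A (Suc n)) \<in> N (Suc n)"
      using z sub by (blast intro: subgrp_diff)+
    then have "x n \<in> N (Suc n)" using n yn eq by (cases "n \<in> A") (auto simp: ySuc)
    then show False using N by blast
  qed
  then show ?thesis using z unfolding lepoll_def by blast
qed

end

section \<open>From the group to its p-torsion\<close>

lemma zero_nbhd_INT:
  assumes "group_topology T"
  shows "finite I \<Longrightarrow> (\<And>i. i \<in> I \<Longrightarrow> zero_nbhd T (f i)) \<Longrightarrow> zero_nbhd T (\<Inter>i\<in>I. f i)"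
  by (induction I rule: finite_induct) (auto simp: zero_nbhd_UNIV[OF assms] zero_nbhd_Int)

lemma subgrp_sumset:
  assumes "subgrp A" "subgrp B"
  shows "subgrp {a + b |a b. a \<in> A \<and> b \<in> B}"
  unfolding subgrp_def
proof (intro conjI ballI)
  show "0 \<in> {a + b |a b. a \<in> A \<and> b \<in> B}" using assms subgrp_zero by force
next
  fix x y assume "x \<in> {a + b |a b. a \<in> A \<and> b \<in> B}" "y \<in> {a + b |a b. a \<in> A \<and> b \<in> B}"
  then obtain a b c d where "x = a + b" "y = c + d" "a \<in> A" "b \<in> B" "c \<in> A" "d \<in> B" by blast
  then have "x - y = (a - c) + (b - d)" "a - c \<in> A" "b - d \<in> B" using assms subgrp_diff by auto
  then show "x - y \<in> {a + b |a b. a \<in> A \<and> b \<in> B}" by blast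
qed

text \<open>Otherwise every prime p has an open subgroup N p without p-torsion. The intersection
  over the finitely many p dividing n is open, hence nontrivial, and a nonzero element of it has a
  multiple of prime order for such a p.\<close>

lemma ex_prime_open_torsion:
  assumes T: "group_topology T" "\<not> zero_nbhd T {0}"
    and n: "n \<ge> 1" "\<And>x::'a::ab_group_add. nat_mult n x = 0"
  shows "\<exists>p. prime p \<and> (\<forall>N::'a set. subgrp N \<longrightarrow> zero_nbhd T N \<longrightarrow> (\<exists>x\<in>N. x \<noteq> 0 \<and> nat_mult p x = 0))"
proof (rule ccontr)
  assume "\<not> ?thesis"
  then obtain N where N: "\<And>p. prime p \<Longrightarrow> subgrp (N p) \<and> zero_nbhd T (N p) \<and> (\<forall>x\<in>N p. nat_mult p x = 0 \<longrightarrow> x = 0)"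
    by metis
  define M where "M = (\<Inter>p\<in>{p. prime p \<and> p dvd n}. N p)"
  have "zero_nbhd T M" unfolding M_def using n N by (intro zero_nbhd_INT[OF T(1)]) auto
  then have "\<not> M \<subseteq> {0}" using T(2) zero_nbhd_mono by blast
  then obtain x where x: "x \<in> M" "x \<noteq> 0" by blast
  obtain p k where pk: "prime p" "p dvd n" "nat_mult k x \<noteq> 0" "nat_mult p (nat_mult k x) = 0"
    using ex_prime_torsion[OF n(2) x(2) n(1)] by blast
  have "nat_mult k x \<in> N p" using x pk N[OF pk(1)] unfolding M_def by (blast intro: subgrp_mult)
  then show False using N pk by blast
qed

lemma continuum_lepoll_if_locally_minimal_GTG:
  fixes T :: "'a::ab_group_add topology"
  assumes n: "n \<ge> 1" "\<And>x::'a. nat_mult n x = 0"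
    and nd: "T \<noteq> discrete_topology UNIV" and lm: "locally_minimal T" and lg: "locally_GTG T"
  shows "(UNIV :: nat set set) \<lesssim> (UNIV :: 'a set)"
proof -
  have T: "group_topology T" and H: "Hausdorff_space T"
    using lm by (auto simp: locally_minimal_def Hausdorff_group_topology_def)
  obtain V where V: "zero_nbhd T V"
    "\<And>S. Hausdorff_group_topology S \<Longrightarrow> coarser S T \<Longrightarrow> zero_nbhd S V \<Longrightarrow> S = T"
    using lm unfolding locally_minimal_def by blast
  have lin: "\<exists>H. subgrp H \<and> zero_nbhd T H \<and> H \<subseteq> W" if "zero_nbhd T W" for W
    using locally_GTG_subgrp[OF lg that n] .
  obtain G where G: "subgrp G" "zero_nbhd T G" "G \<subseteq> V" using lin[OF V(1)] by blast
  have Int_G: "subgrp (N \<inter> G)" "zero_nbhd T (N \<inter> G)" if "subgrp N" "zero_nbhd T N" for N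
    using that G subgrp_Int zero_nbhd_Int by blast+
  have nd0: "\<not> zero_nbhd T {0}" using nd discrete_iff_zero_nbhd[OF T] by blast
  obtain p where p: "prime p"
    "\<And>N. subgrp N \<Longrightarrow> zero_nbhd T N \<Longrightarrow> \<exists>x\<in>N. x \<noteq> 0 \<and> nat_mult p x = 0"
    using ex_prime_open_torsion[OF T nd0 n] by blast
  define S where "S = G \<inter> {x. nat_mult p x = 0}"
  have subS: "subgrp S" unfolding S_def using G(1) subgrp_torsion by (rule subgrp_Int)
  have sep: "\<exists>N. subgrp N \<and> zero_nbhd T N \<and> x \<notin> N" if "x \<noteq> 0" for x
  proof -
    have "0 \<in> topspace T \<and> x \<in> topspace T \<and> 0 \<noteq> x"
      using that group_topology_topspace[OF T] by simp
    then have "\<exists>U W. openin T U \<and> openin T W \<and> 0 \<in> U \<and> x \<in> W \<and> disjnt U W"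
      using H unfolding Hausdorff_space_def by metis
    then obtain U W where "openin T U" "0 \<in> U" "x \<in> W" "disjnt U W" by blast
    then have "zero_nbhd T U" "x \<notin> U" by (auto simp: zero_nbhd_open disjnt_iff)
    then show ?thesis using lin by blast
  qed
  \<comment> \<open>The open subgroups of S in the subspace topology: those containing the trace of
    an open subgroup of the group.\<close>
  define Opn where "Opn = (\<lambda>A. subgrp A \<and> A \<subseteq> S \<and> (\<exists>N. subgrp N \<and> zero_nbhd T N \<and> N \<inter> S \<subseteq> A))"
  interpret minimal_linear p S Opn
  proof
    show "Opn S" using G subS unfolding Opn_def by blast
  next
    fix A B assume "Opn A" "Opn B"
    then obtain M N where MN: "subgrp M" "zero_nbhd T M" "M \<inter> S \<subseteq> A" "subgrp N" "zero_nbhd T N" "N \<inter> S \<subseteq> B"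
      unfolding Opn_def by blast
    then have "subgrp (M \<inter> N)" "zero_nbhd T (M \<inter> N)" "M \<inter> N \<inter> S \<subseteq> A \<inter> B"
      using subgrp_Int zero_nbhd_Int by blast+
    then show "Opn (A \<inter> B)" using \<open>Opn A\<close> \<open>Opn B\<close> subgrp_Int unfolding Opn_def by blast
  next
    fix x assume "x \<in> S" "x \<noteq> 0"
    then obtain N where "subgrp N" "zero_nbhd T N" "x \<notin> N" using sep by blast
    then show "\<exists>A. Opn A \<and> x \<notin> A" using subS subgrp_Int unfolding Opn_def
      by (intro exI[of _ "N \<inter> S"]) blast
  next
    show "\<not> Opn {0}"
    proof
      assume "Opn {0}"
      then obtain N where N: "subgrp N" "zero_nbhd T N" "N \<inter> S \<subseteq> {0}" unfolding Opn_def by blast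
      then obtain x where "x \<in> N \<inter> G" "x \<noteq> 0" "nat_mult p x = 0"
        using p(2)[OF Int_G] by metis
      then show False using N(3) unfolding S_def by blast
    qed
  next
    fix \<B> A assume L: "lin_base \<B>" and Opn\<B>: "\<And>B. B \<in> \<B> \<Longrightarrow> Opn B" and I: "\<Inter>\<B> \<subseteq> {0}" and A: "Opn A"
    define s where "s = (\<lambda>N B. {a + b |a b. a \<in> N \<and> b \<in> (B::'a set)})"
    define \<C> where "\<C> = {s N B |N B. subgrp N \<and> zero_nbhd T N \<and> N \<subseteq> G \<and> B \<in> \<B>}"
    have s_mono: "s N B \<subseteq> s N' B'" if "N \<subseteq> N'" "B \<subseteq> B'" for N N' B B'
      unfolding s_def using that by blast
    have s_left: "N \<subseteq> s N B" if "B \<in> \<B>" for N B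
      unfolding s_def using that L subgrp_zero unfolding lin_base_def by force
    have s_right: "B \<subseteq> s N B" if "subgrp N" for N B
      unfolding s_def using subgrp_zero[OF that] by force
    obtain B0 where B0: "B0 \<in> \<B>" using L unfolding lin_base_def by blast
    have base: "lin_base \<C>"
      unfolding lin_base_def
    proof (intro conjI ballI)
      show "\<C> \<noteq> {}" using G B0 unfolding \<C>_def by blast
    next
      fix C assume "C \<in> \<C>"
      then show "subgrp C" using subgrp_sumset L unfolding \<C>_def s_def lin_base_def by blast
    next
      fix C D assume "C \<in> \<C>" "D \<in> \<C>"
      then obtain N B N' B' where C: "C = s N B" "subgrp N" "zero_nbhd T N" "N \<subseteq> G" "B \<in> \<B>"
        and D: "D = s N' B'" "subgrp N'" "zero_nbhd T N'" "N' \<subseteq> G" "B' \<in> \<B>"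
        unfolding \<C>_def by blast
      then obtain B'' where B'': "B'' \<in> \<B>" "B'' \<subseteq> B" "B'' \<subseteq> B'" using L unfolding lin_base_def by (meson le_inf_iff)
      have "s (N \<inter> N') B'' \<in> \<C>"
        unfolding \<C>_def using C D B'' subgrp_Int zero_nbhd_Int by blast
      moreover have "s (N \<inter> N') B'' \<subseteq> C \<inter> D" using C(1) D(1) s_mono B'' by (metis inf_le1 inf_le2 le_inf_iff)
      ultimately show "\<exists>X\<in>\<C>. X \<subseteq> C \<inter> D" by blast
    qed
    have sep0: "\<Inter>\<C> \<subseteq> {0}"
    proof
      fix x assume x: "x \<in> \<Inter>\<C>"
      have x_s: "x \<in> s N B" if "subgrp N" "zero_nbhd T N" "N \<subseteq> G" "B \<in> \<B>" for N B
        using x that unfolding \<C>_def by blast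
      have B_S: "B \<subseteq> S" if "B \<in> \<B>" for B using Opn\<B> that unfolding Opn_def by blast
      \<comment> \<open>Write x = a + b with a in N; then p x = p a, as p kills b.\<close>
      have "nat_mult p x \<in> N" if N: "subgrp N" "zero_nbhd T N" for N
      proof -
        have "x \<in> s (N \<inter> G) B0" using x_s[OF Int_G[OF N] _ B0] by simp
        then obtain a b where "x = a + b" "a \<in> N" "b \<in> S" unfolding s_def using B_S[OF B0] by blast
        then show ?thesis using N subgrp_mult by (auto simp: nat_mult_plus S_def)
      qed
      then have px: "nat_mult p x = 0" using sep by blast
      obtain a b where "x = a + b" "a \<in> G" "b \<in> S"
        using x_s[OF G(1,2) order_refl B0] B_S[OF B0] unfolding s_def by blast
      then have "x \<in> G" using G(1) subgrp_add unfolding S_def by blast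
      then have xS: "x \<in> S" using px by (simp add: S_def)
      \<comment> \<open>Take N with trace on S inside B. In x = a + b the summand a = x - b lies in
        S, hence in B.\<close>
      have "x \<in> B" if B: "B \<in> \<B>" for B
      proof -
        obtain N where N: "subgrp N" "zero_nbhd T N" "N \<inter> S \<subseteq> B" and subB: "subgrp B"
          using Opn\<B>[OF B] unfolding Opn_def by blast
        have "x \<in> s (N \<inter> G) B" using x_s[OF Int_G[OF N(1,2)] _ B] by simp
        then obtain a b where ab: "x = a + b" "a \<in> N" "b \<in> B" unfolding s_def by blast
        then have "a = x - b" by simp
        then have "a \<in> S" using xS ab B_S[OF B] subS subgrp_diff by blast
        then show ?thesis using ab N subB subgrp_add by blast
      qed
      then show "x \<in> {0}" using I by blast
    qed
    have nbhd: "zero_nbhd T C" if "C \<in> \<C>" for C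
    proof -
      obtain N B where "C = s N B" "zero_nbhd T N" "B \<in> \<B>" using \<open>C \<in> \<C>\<close> unfolding \<C>_def by blast
      then show ?thesis using zero_nbhd_mono[OF _ s_left] by blast
    qed
    have mem: "s G B0 \<in> \<C>" unfolding \<C>_def using G B0 by blast
    have sub: "s G B0 \<subseteq> V"
    proof -
      have "B0 \<subseteq> G" using Opn\<B>[OF B0] unfolding Opn_def S_def by blast
      then have "s G B0 \<subseteq> G" unfolding s_def using G(1) subgrp_add by blast
      then show ?thesis using G(3) by blast
    qed
    obtain N where N: "zero_nbhd T N" "N \<inter> S \<subseteq> A" using A unfolding Opn_def by blast
    obtain C where C: "C \<in> \<C>" "C \<subseteq> N"
      using locally_minimal_lin_base[OF V(2) T base sep0 nbhd mem sub N(1)] by blast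
    then obtain M B where "subgrp M" "C = s M B" "B \<in> \<B>" unfolding \<C>_def by blast
    then have "B \<subseteq> N" "B \<in> \<B>" using s_right C by blast+
    moreover have "B \<subseteq> S" using Opn\<B>[OF \<open>B \<in> \<B>\<close>] unfolding Opn_def by blast
    ultimately show "\<exists>B\<in>\<B>. B \<subseteq> A" using N by blast
  next
    fix A B assume "Opn A" "subgrp B" "A \<subseteq> B" "B \<subseteq> S"
    then show "Opn B" unfolding Opn_def by (meson order_trans)
  qed (auto simp: Opn_def S_def p subS[unfolded S_def])
  show ?thesis using continuum_lepoll lepoll_trans subset_imp_lepoll subset_UNIV by blast
qed

subsection \<open>Locally compact groups\<close>

lemma continuum_lepoll_if_locally_compact:
  fixes T :: "'a::ab_group_add topology"
  assumes T: "group_topology T" and nd: "T \<noteq> discrete_topology UNIV"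
    and "locally_compact_space T" "metrizable_space T"
  shows "(UNIV :: nat set set) \<lesssim> (UNIV :: 'a set)"
proof -
  have "x \<in> T derived_set_of UNIV" for x :: 'a
    unfolding in_derived_set_of
  proof (intro conjI allI impI)
    fix U assume U: "x \<in> U \<and> openin T U"
    show "\<exists>y. y \<noteq> x \<and> y \<in> UNIV \<and> y \<in> U"
    proof (rule ccontr)
      \<comment> \<open>An isolated point, translated to zero, would make the topology
        discrete.\<close>
      assume "\<not> ?thesis"
      then have "U = {x}" using U by blast
      then have "{y. x + y \<in> U} = {0}" by simp
      then have "zero_nbhd T {0}" using openin_translate[OF T, of U x] U by (auto intro: zero_nbhd_open)
      then show False using nd discrete_iff_zero_nbhd[OF T] by blast
    qed
  qed (simp add: group_topology_topspace[OF T])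
  then have "T derived_set_of UNIV = UNIV" by blast
  then have "(UNIV :: real set) \<lesssim> (UNIV :: 'a set)"
    using lepoll_perfect_set[of T UNIV] assms metrizable_imp_Hausdorff_space by blast
  then show ?thesis using nat_sets_eqpoll_reals lepoll_trans1 by blast
qed

text \<open>K itself is the witness. For W open in T, the set K - W is compact for T, hence compact
  and therefore closed for a coarser Hausdorff S; removing it from the S-neighbourhood K leaves an
  S-neighbourhood inside W.\<close>

lemma locally_minimal_if_compact_nbhd:
  assumes T: "Hausdorff_group_topology T" and K: "zero_nbhd T K" "compactin T K"
  shows "locally_minimal T"
  unfolding locally_minimal_def
proof (intro conjI exI[of _ K] allI impI)
  fix S assume S: "Hausdorff_group_topology S \<and> coarser S T \<and> zero_nbhd S K"
  have gT: "group_topology T" and gS: "group_topology S" "Hausdorff_space S"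
    using T S by (auto simp: Hausdorff_group_topology_def)
  have "zero_nbhd S N" if N: "zero_nbhd T N" for N
  proof -
    obtain W where W: "openin T W" "0 \<in> W" "W \<subseteq> N" using N unfolding zero_nbhd_def by blast
    have "closedin T (topspace T - W)" using W(1) by blast
    then have "compactin T (K \<inter> (topspace T - W))" using K(2) by (simp add: compact_Int_closedin)
    moreover have "continuous_map T S id"
      using S gT gS(1) by (auto simp: continuous_map_def group_topology_topspace coarser_def)
    ultimately have "compactin S (K - W)"
      using image_compactin gT by (fastforce simp: group_topology_topspace Diff_eq)
    then have "closedin S (K - W)" using gS(2) by (rule compactin_imp_closedin[rotated])
    then have "openin S (- (K - W))" using gS(1) by (simp add: closedin_def group_topology_topspace Compl_eq_Diff_UNIV)
    then have "zero_nbhd S (- (K - W))" using W(2) by (intro zero_nbhd_open) auto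
    then have "zero_nbhd S (- (K - W) \<inter> K)" using S zero_nbhd_Int by blast
    then show ?thesis by (rule zero_nbhd_mono) (use W(3) in auto)
  qed
  moreover have "zero_nbhd T N" if "zero_nbhd S N" for N
    using that S unfolding zero_nbhd_def coarser_def by blast
  ultimately show "S = T" using group_topology_eqI[OF gS(1) gT] by blast
qed (use T K in auto)

lemma locally_compact_if_compact_nbhd:
  assumes T: "group_topology T" and K: "zero_nbhd T K" "compactin T K"
  shows "locally_compact_space T"
  unfolding locally_compact_space_def
proof
  fix x
  obtain W where W: "openin T W" "0 \<in> W" "W \<subseteq> K" using K(1) unfolding zero_nbhd_def by blast
  have "compactin T ((\<lambda>y. x + y) ` K)"
    using image_compactin[OF K(2) continuous_map_translate[OF T]] .
  moreover have "openin T {y. - x + y \<in> W}" by (rule openin_translate[OF T W(1)])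
  moreover have "{y. - x + y \<in> W} \<subseteq> (\<lambda>y. x + y) ` K"
  proof
    fix y assume "y \<in> {y. - x + y \<in> W}"
    then show "y \<in> (\<lambda>y. x + y) ` K" using W(3) by (intro image_eqI[of _ _ "- x + y"]) auto
  qed
  ultimately show "\<exists>U K. openin T U \<and> compactin T K \<and> x \<in> U \<and> U \<subseteq> K" using W(2)
    by (intro exI[of _ "{y. - x + y \<in> W}"] exI[of _ "(\<lambda>y. x + y) ` K"]) auto
qed

text \<open>All the sets (1/n)H equal H, so the topology with the single basic neighbourhood H is a
  witness.\<close>

lemma GTG_subset_subgrp:
  assumes H: "subgrp H"
  shows "GTG_subset H"
proof -
  have frac: "frac_set n H = H" if "n \<ge> 1" for n
  proof
    show "frac_set n H \<subseteq> H"
    proof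
      fix x assume "x \<in> frac_set n H"
      moreover have "1 \<in> {1..n}" using that by simp
      ultimately have "nat_mult 1 x \<in> H" unfolding frac_set_def by blast
      then show "x \<in> H" by simp
    qed
    show "H \<subseteq> frac_set n H" using subgrp_mult[OF H] by (auto simp: frac_set_def)
  qed
  have L: "lin_base {H}" using H by (simp add: lin_base_def)
  have "uminus ` H = H"
  proof
    show "uminus ` H \<subseteq> H" using subgrp_minus[OF H] by blast
    show "H \<subseteq> uminus ` H"
    proof
      fix x assume "x \<in> H"
      then show "x \<in> uminus ` H" using subgrp_minus[OF H] by (intro image_eqI[of _ _ "- x"]) auto
    qed
  qed
  moreover have "\<forall>n\<ge>1. zero_nbhd (lin_top {H}) (frac_set n H)"
    using frac by (simp add: zero_nbhd_lin_top[OF L])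
  moreover have "\<forall>V. zero_nbhd (lin_top {H}) V \<longrightarrow> (\<exists>n\<ge>1. frac_set n H \<subseteq> V)"
    using frac[of 1] by (auto simp: zero_nbhd_lin_top[OF L])
  ultimately show ?thesis
    unfolding GTG_subset_def using subgrp_zero[OF H] group_topology_lin_top[OF L] by blast
qed

lemma locally_GTG_lin_top:
  assumes L: "lin_base \<B>" and "\<Inter>\<B> \<subseteq> {0}"
  shows "locally_GTG (lin_top \<B>)"
  unfolding locally_GTG_def neighbourhood_base_at_def
proof (intro conjI allI impI)
  show "Hausdorff_group_topology (lin_top \<B>)" using assms by (rule Hausdorff_lin_top)
next
  fix W assume "openin (lin_top \<B>) W \<and> 0 \<in> W"
  then obtain B where B: "B \<in> \<B>" "B \<subseteq> W" using zero_nbhd_lin_top[OF L] zero_nbhd_open by metis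
  then have sub: "subgrp B" using L by (simp add: lin_base_def)
  have "openin (lin_top \<B>) B" using lin_base_coset[OF L B(1), of 0] by simp
  then show "\<exists>U V. openin (lin_top \<B>) U \<and> GTG_subset V \<and> 0 \<in> U \<and> U \<subseteq> V \<and> V \<subseteq> W"
    using B sub GTG_subset_subgrp subgrp_zero by blast
qed

section \<open>Metrizability of a topology given by a decreasing sequence of subgroups\<close>

lemma lin_base_decseq:
  assumes "\<And>n. subgrp (K n)" and "decseq K"
  shows "lin_base (range K)"
  unfolding lin_base_def
proof (intro conjI ballI)
  fix A B assume "A \<in> range K" "B \<in> range K"
  then obtain m n where "A = K m" "B = K n" by blast
  then have "K (max m n) \<subseteq> A \<inter> B" using assms(2) by (simp add: decseq_def)
  then show "\<exists>C\<in>range K. C \<subseteq> A \<inter> B" by blast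
qed (use assms(1) in auto)

text \<open>The size \<nu> z is governed by the first index at which z leaves the sequence. As the K
  n are subgroups, \<nu> is an ultrametric norm, and its balls of radius 1 / (1 + n) are the cosets
  of K n.\<close>

lemma metrizable_lin_top:
  assumes sub: "\<And>n. subgrp (K n)" and "decseq K" and I: "(\<Inter>n. K n) \<subseteq> {0}"
  shows "metrizable_space (lin_top (range K))"
proof -
  have anti: "K m \<subseteq> K n" if "n \<le> m" for n m using \<open>decseq K\<close> that by (auto simp: decseq_def)
  have L: "lin_base (range K)" using sub \<open>decseq K\<close> by (rule lin_base_decseq)
  define N where "N = (\<lambda>z. LEAST n. z \<notin> K n)"
  \<comment> \<open>Zero never leaves the sequence, so its value has to be set separately.\<close>
  define \<nu> where "\<nu> = (\<lambda>z. if z = 0 then 0 else 1 / (1 + real (N z)))"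
  have N: "z \<in> K n \<longleftrightarrow> n < N z" if "z \<noteq> 0" for z n
  proof
    have "\<exists>n. z \<notin> K n" using I that by blast
    then have "z \<notin> K (N z)" unfolding N_def by (rule LeastI_ex)
    then show "n < N z" if "z \<in> K n" using anti[of "N z" n] that by (meson linorder_not_less subsetD)
    show "z \<in> K n" if "n < N z" using not_less_Least[of n "\<lambda>n. z \<notin> K n"] that unfolding N_def by blast
  qed
  have \<nu>_less: "\<nu> z < 1 / (1 + real n) \<longleftrightarrow> z \<in> K n" for z n
    using N[of z n] sub subgrp_zero by (auto simp: \<nu>_def field_simps)
  have \<nu>_nonneg: "0 \<le> \<nu> z" for z by (simp add: \<nu>_def)
  have \<nu>_diff: "\<nu> (x - y) \<le> \<nu> x + \<nu> y" for x y
  proof (cases "x - y = 0")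
    case False
    have "x - y \<notin> K (N (x - y))" using N[OF False] by blast
    then have "x \<notin> K (N (x - y)) \<or> y \<notin> K (N (x - y))" using sub subgrp_diff by blast
    then have "\<nu> x \<ge> \<nu> (x - y) \<or> \<nu> y \<ge> \<nu> (x - y)"
      using False \<nu>_less by (metis \<nu>_def linorder_not_less)
    then show ?thesis using \<nu>_nonneg[of x] \<nu>_nonneg[of y] by linarith
  qed (use \<nu>_nonneg in \<open>simp add: \<nu>_def\<close>)
  have \<nu>_minus: "\<nu> (x - y) = \<nu> (y - x)" for x y
    using \<nu>_diff[of 0 "x - y"] \<nu>_diff[of 0 "y - x"] by (simp add: \<nu>_def)
  interpret Metric_space UNIV "\<lambda>x y. \<nu> (x - y)"
  proof
    fix x y z
    show "\<nu> (x - z) \<le> \<nu> (x - y) + \<nu> (y - z)"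
      using \<nu>_diff[of "x - y" "z - y"] \<nu>_minus[of z y] by simp
    show "\<nu> (x - y) = 0 \<longleftrightarrow> x = y" by (simp add: \<nu>_def)
  qed (use \<nu>_nonneg \<nu>_minus in auto)
  have "openin mtopology U \<longleftrightarrow> openin (lin_top (range K)) U" for U
  proof -
    have "(\<exists>r>0. mball x r \<subseteq> U) \<longleftrightarrow> (\<exists>n. \<forall>b\<in>K n. x + b \<in> U)" for x
    proof
      assume "\<exists>r>0. mball x r \<subseteq> U"
      then obtain r where r: "r > 0" "mball x r \<subseteq> U" by blast
      then obtain n where n: "1 / real (Suc n) < r" by (meson nat_approx_posE)
      have "x + b \<in> U" if "b \<in> K n" for b
      proof -
        have "- b \<in> K n" using sub subgrp_minus that by blast
        then have "\<nu> (x - (x + b)) < r" using \<nu>_less[of "- b" n] n by simp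
        then show ?thesis using r by auto
      qed
      then show "\<exists>n. \<forall>b\<in>K n. x + b \<in> U" by blast
    next
      assume "\<exists>n. \<forall>b\<in>K n. x + b \<in> U"
      then obtain n where n: "\<forall>b\<in>K n. x + b \<in> U" by blast
      have "mball x (1 / (1 + real n)) \<subseteq> U"
      proof
        fix y assume "y \<in> mball x (1 / (1 + real n))"
        then have "\<nu> (y - x) < 1 / (1 + real n)" by (simp add: \<nu>_minus)
        then have "x + (y - x) \<in> U" using n \<nu>_less by blast
        then show "y \<in> U" by simp
      qed
      then show "\<exists>r>0. mball x r \<subseteq> U" by (intro exI[of _ "1 / (1 + real n)"]) auto
    qed
    then show ?thesis unfolding openin_mtopology openin_lin_top[OF L] by auto
  qed
  then have "mtopology = lin_top (range K)" by (simp add: topology_eq)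
  then show ?thesis using metrizable_space_mtopology by simp
qed

subsection \<open>Cardinalities\<close>

lemma infinite_Times_lepoll_self: "infinite A \<Longrightarrow> A \<times> A \<lesssim> A"
  by (simp add: eqpoll_iff_card_of_ordIso card_of_Times_same_infinite eqpoll_imp_lepoll)

lemma lepoll_total: "A \<lesssim> B \<or> B \<lesssim> A"
  unfolding lepoll_def card_of_ordLeq by (simp add: ordLeq_total card_of_Well_order)

text \<open>X injects into B x B, so B cannot be finite; and an infinite B absorbs its
  square.\<close>

lemma infinite_lepoll_Times_mono:
  assumes X: "infinite X" "X \<lesssim> A \<times> B" and "A \<lesssim> B"
  shows "X \<lesssim> B"
proof -
  have XBB: "X \<lesssim> B \<times> B"
    using X(2) times_lepoll_mono[OF \<open>A \<lesssim> B\<close> lepoll_refl[of B]] lepoll_trans by blast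
  then have "infinite B" using X(1) by (meson finite_SigmaI lepoll_iff finite_surj)
  then show ?thesis using XBB infinite_Times_lepoll_self lepoll_trans by blast
qed

lemma infinite_lepoll_TimesD:
  assumes X: "infinite X" "X \<lesssim> A \<times> B"
  shows "X \<lesssim> A \<or> X \<lesssim> B"
proof -
  have "X \<lesssim> B \<times> A" using X(2) times_commute_eqpoll lepoll_trans2 by blast
  then show ?thesis
    using lepoll_total[of A B] infinite_lepoll_Times_mono[OF X] infinite_lepoll_Times_mono[OF X(1)] by metis
qed

text \<open>By induction the lists of a fixed length inject into B; a list is determined by its
  length and this code.\<close>

lemma lists_lepoll:
  assumes B: "infinite B"
  shows "lists B \<lesssim> B"
proof -
  have "{xs \<in> lists B. length xs = n} \<lesssim> B" for n
  proof (induction n)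
    case 0
    obtain b where "b \<in> B" using B by fastforce
    have "{xs \<in> lists B. length xs = 0} \<subseteq> (\<lambda>_. []) ` B" using \<open>b \<in> B\<close> by auto
    then show ?case by (rule subset_image_lepoll)
  next
    case (Suc n)
    have "{xs \<in> lists B. length xs = Suc n} \<subseteq> (\<lambda>(x, xs). x # xs) ` (B \<times> {xs \<in> lists B. length xs = n})"
      by (auto simp: length_Suc_conv image_iff)
    then have "{xs \<in> lists B. length xs = Suc n} \<lesssim> B \<times> {xs \<in> lists B. length xs = n}"
      by (rule subset_image_lepoll)
    also have "\<dots> \<lesssim> B \<times> B" using Suc by (simp add: times_lepoll_mono)
    also have "\<dots> \<lesssim> B" using B by (rule infinite_Times_lepoll_self)
    finally show ?case .
  qed
  then have "\<forall>n. \<exists>f. inj_on f {xs \<in> lists B. length xs = n} \<and> f ` {xs \<in> lists B. length xs = n} \<subseteq> B"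
    unfolding lepoll_def by blast
  from choice[OF this] obtain f where "\<forall>n. inj_on (f n) {xs \<in> lists B. length xs = n} \<and>
    f n ` {xs \<in> lists B. length xs = n} \<subseteq> B" by (rule exE)
  then have f: "inj_on (f n) {xs \<in> lists B. length xs = n}"
    "f n ` {xs \<in> lists B. length xs = n} \<subseteq> B" for n by simp_all
  have "inj_on (\<lambda>xs. (length xs, f (length xs) xs)) (lists B)"
  proof (rule inj_onI)
    fix xs ys assume xy: "xs \<in> lists B" "ys \<in> lists B" "(length xs, f (length xs) xs) = (length ys, f (length ys) ys)"
    then show "xs = ys" using inj_onD[OF f(1)[of "length xs"], of xs ys] by auto
  qed
  moreover have "(\<lambda>xs. (length xs, f (length xs) xs)) ` lists B \<subseteq> (UNIV :: nat set) \<times> B"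
    using f(2) by auto
  ultimately have "lists B \<lesssim> (UNIV :: nat set) \<times> B" unfolding lepoll_def by blast
  also have "\<dots> \<lesssim> B \<times> B" using B infinite_le_lepoll by (intro times_lepoll_mono) auto
  also have "\<dots> \<lesssim> B" using B by (rule infinite_Times_lepoll_self)
  finally show ?thesis .
qed

text \<open>A injects into pA x A[p]: keep p x, and subtract from x a chosen preimage of p x (no
  homomorphism is required of the choice). If X does not fit into A[p], it fits into pA, whose
  exponent is the smaller m / p.\<close>

lemma infinite_lepoll_torsion:
  assumes "subgrp A" "\<And>x. x \<in> A \<Longrightarrow> nat_mult m x = 0" "m \<ge> 1" "infinite X" "X \<lesssim> A"
  shows "\<exists>p. prime p \<and> X \<lesssim> {x \<in> A. nat_mult p x = 0}"
  using assms
proof (induction m arbitrary: A rule: less_induct)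
  case (less m)
  have "m \<noteq> 1"
  proof
    assume "m = 1"
    then have "A \<subseteq> {0}" using less.prems(2) by auto
    then have "finite A" by (rule finite_subset) simp
    then show False using less.prems(4,5) by (meson lepoll_iff finite_surj)
  qed
  then obtain p where p: "prime p" "p dvd m" using prime_factor_nat by blast
  then obtain k where k: "m = p * k" by blast
  have "k \<noteq> 0" using less.prems(3) k by (metis mult_0_right not_one_le_zero)
  then have km: "k < m" "k \<ge> 1" using k prime_gt_1_nat[OF p(1)] by simp_all
  define B where "B = nat_mult p ` A"
  define r where "r = inv_into A (nat_mult p)"
  have r: "r b \<in> A" "nat_mult p (r b) = b" if "b \<in> B" for b
    using that unfolding B_def r_def by (auto simp: inv_into_into f_inv_into_f)
  let ?f = "\<lambda>x. (nat_mult p x, x - r (nat_mult p x))"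
  have "inj_on ?f A" by (rule inj_onI) auto
  moreover have "?f ` A \<subseteq> B \<times> {x \<in> A. nat_mult p x = 0}"
  proof (rule image_subsetI)
    fix x assume x: "x \<in> A"
    then have "nat_mult p x \<in> B" by (simp add: B_def)
    then show "?f x \<in> B \<times> {x \<in> A. nat_mult p x = 0}"
      using r x subgrp_diff[OF less.prems(1)] by (simp add: nat_mult_diff)
  qed
  ultimately have "A \<lesssim> B \<times> {x \<in> A. nat_mult p x = 0}" unfolding lepoll_def by blast
  then consider "X \<lesssim> B" | "X \<lesssim> {x \<in> A. nat_mult p x = 0}"
    using infinite_lepoll_TimesD[OF less.prems(4)] less.prems(5) lepoll_trans by blast
  then show ?case
  proof cases
    case 1
    have subB: "subgrp B"
      unfolding subgrp_def B_def
    proof (intro conjI ballI)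
      show "0 \<in> nat_mult p ` A" using subgrp_zero[OF less.prems(1)] by (metis imageI nat_mult_zero)
    next
      fix x y assume "x \<in> nat_mult p ` A" "y \<in> nat_mult p ` A"
      then show "x - y \<in> nat_mult p ` A"
        using subgrp_diff[OF less.prems(1)] by (auto simp flip: nat_mult_diff)
    qed
    have "nat_mult k x = 0" if "x \<in> B" for x
      using that less.prems(2) unfolding B_def k by (auto simp: mult.commute simp flip: nat_mult_mult)
    then obtain q where q: "prime q" "X \<lesssim> {x \<in> B. nat_mult q x = 0}"
      using less.IH[OF km(1) subB _ km(2) less.prems(4) 1] by blast
    have "{x \<in> B. nat_mult q x = 0} \<subseteq> {x \<in> A. nat_mult q x = 0}"
      using subgrp_mult[OF less.prems(1)] unfolding B_def by blast
    then show ?thesis using q lepoll_trans subset_imp_lepoll by blast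
  qed (use p in blast)
qed

subsection \<open>Independent sets in groups of prime exponent\<close>

text \<open>Formally the generated submonoid; it is the generated subgroup once X has bounded
  exponent. Sums of lists make its cardinality at most that of \<open>lists X\<close>.\<close>

definition gen :: "'a::ab_group_add set \<Rightarrow> 'a set" where
  "gen X = sum_list ` lists X"

lemma gen_mono: "X \<subseteq> Y \<Longrightarrow> gen X \<subseteq> gen Y"
  unfolding gen_def by (intro image_mono lists_mono)

lemma gen_superset: "X \<subseteq> gen X"
proof
  fix x assume "x \<in> X"
  then show "x \<in> gen X" unfolding gen_def by (intro image_eqI[of _ _ "[x]"]) auto
qed

lemma gen_finite: "x \<in> gen X \<Longrightarrow> \<exists>F\<subseteq>X. finite F \<and> x \<in> gen F"
  unfolding gen_def by (metis finite_set image_iff in_listsI in_lists_conv_set subsetI)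

lemma subgrp_gen:
  assumes n: "n \<ge> 1" "\<And>x. x \<in> X \<Longrightarrow> nat_mult n x = 0"
  shows "subgrp (gen X)"
proof -
  have zero: "0 \<in> gen X" unfolding gen_def by (intro image_eqI[of _ _ "[]"]) auto
  have add: "x + y \<in> gen X" if xy: "x \<in> gen X" "y \<in> gen X" for x y
  proof -
    obtain xs ys where "x = sum_list xs" "y = sum_list ys" "xs \<in> lists X" "ys \<in> lists X"
      using xy unfolding gen_def by blast
    then show ?thesis unfolding gen_def by (intro image_eqI[of _ _ "xs @ ys"]) auto
  qed
  have mult: "nat_mult k x \<in> gen X" if "x \<in> gen X" for k x
    by (induction k) (auto intro: zero add that)
  have "nat_mult n (sum_list xs) = 0" if "xs \<in> lists X" for xs
    using that by (induction xs) (auto simp: nat_mult_plus n)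
  then have tors: "nat_mult n x = 0" if "x \<in> gen X" for x using that unfolding gen_def by blast
  obtain m where m: "n = Suc m" using n by (cases n) auto
  have "- y = nat_mult m y" if "y \<in> gen X" for y
    using tors[OF that] unfolding m by (simp add: neg_eq_iff_add_eq_0)
  then have "x - y \<in> gen X" if "x \<in> gen X" "y \<in> gen X" for x y
    using add[OF that(1) mult[OF that(2), of m]] that by (simp add: diff_conv_add_uminus del: add_uminus_conv_diff)
  then show ?thesis using zero by (simp add: subgrp_def)
qed

lemma gen_least: "subgrp H \<Longrightarrow> X \<subseteq> H \<Longrightarrow> gen X \<subseteq> H"
proof -
  assume H: "subgrp H" "X \<subseteq> H"
  have "sum_list xs \<in> H" if "xs \<in> lists X" for xs
    using that by (induction xs) (use H in \<open>auto intro: subgrp_zero subgrp_add\<close>)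
  then show "gen X \<subseteq> H" unfolding gen_def by blast
qed

text \<open>In a group of prime exponent p this is linear independence over Z/p.\<close>

definition indep :: "'a::ab_group_add set \<Rightarrow> bool" where
  "indep B \<longleftrightarrow> (\<forall>b\<in>B. b \<notin> gen (B - {b}))"

text \<open>The existence of a basis over Z/p: a maximal independent set generates, by
  exchange.\<close>

lemma ex_independent_generating:
  assumes p: "prime p" and S: "subgrp S" "\<And>x. x \<in> S \<Longrightarrow> nat_mult p x = 0"
  shows "\<exists>B\<subseteq>S. indep B \<and> S \<subseteq> gen B"
proof -
  let ?\<A> = "{B. B \<subseteq> S \<and> indep B}"
  have "\<exists>M\<in>?\<A>. \<forall>X\<in>?\<A>. M \<subseteq> X \<longrightarrow> X = M"
  proof (rule subset_Zorn_nonempty)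
    have "{} \<in> ?\<A>" by (simp add: indep_def)
    then show "?\<A> \<noteq> {}" by blast
  next
    fix C assume C: "C \<noteq> {}" "subset.chain ?\<A> C"
    \<comment> \<open>A dependence involves finitely many elements, so it would already occur in one
      member of the chain.\<close>
    have "b \<notin> gen (\<Union>C - {b})" if "b \<in> \<Union>C" for b
    proof
      assume "b \<in> gen (\<Union>C - {b})"
      then obtain F where F: "F \<subseteq> \<Union>C - {b}" "finite F" "b \<in> gen F" using gen_finite by blast
      have "insert b F \<subseteq> \<Union>C" using F that by blast
      then obtain X where X: "X \<in> C" "insert b F \<subseteq> X"
        using finite_subset_Union_chain[of "insert b F" C] C F(2) by blast
      then have "b \<in> gen (X - {b})" using F gen_mono[of F "X - {b}"] by blast
      moreover have "indep X" using X C by (auto simp: subset_chain_def)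
      ultimately show False using X by (auto simp: indep_def)
    qed
    then have "indep (\<Union>C)" by (simp add: indep_def)
    then show "\<Union>C \<in> ?\<A>" using C by (auto simp: subset_chain_def)
  qed
  then obtain B where "B \<in> ?\<A>" and max: "\<forall>X\<in>?\<A>. B \<subseteq> X \<longrightarrow> X = B" by (rule bexE)
  then have B: "B \<subseteq> S" "indep B" by simp_all
  have p1: "p \<ge> 1" using prime_ge_1_nat[OF p] .
  have subgen: "subgrp (gen X)" if "X \<subseteq> S" for X
    using subgrp_gen[OF p1] that S(2) by blast
  have "x \<in> gen B" if x: "x \<in> S" for x
  proof (rule ccontr)
    assume nx: "x \<notin> gen B"
    have "b \<notin> gen (insert x B - {b})" if b: "b \<in> insert x B" for b
    proof (cases "b = x")
      case True
      have "gen (insert x B - {b}) \<subseteq> gen B" using True by (intro gen_mono) blast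
      then show ?thesis using nx True by blast
    next
      case False
      then have bB: "b \<in> B" using b by blast
      \<comment> \<open>If b depended on x together with the rest of B, exchange would make x depend
        on B.\<close>
      let ?A = "gen (B - {b})"
      have sA: "subgrp ?A" using B by (intro subgen) blast
      have px: "nat_mult p x \<in> ?A" using S(2)[OF x] subgrp_zero[OF sA] by simp
      show ?thesis
      proof
        assume "b \<in> gen (insert x B - {b})"
        moreover have "insert x B - {b} \<subseteq> adj ?A x"
          using adj_self[OF sA] adj_subset[of ?A x] gen_superset[of "B - {b}"] by blast
        ultimately have "b \<in> adj ?A x" using gen_least[OF subgrp_adj[OF sA p1 px]] by blast
        moreover have "b \<notin> ?A" using B bB by (simp add: indep_def)
        ultimately have "x \<in> adj ?A b" using adj_exchange[OF sA p px] by blast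
        moreover have "adj ?A b \<subseteq> gen B"
          using bB gen_superset[of B] by (intro adj_subset_subgrp subgen B gen_mono) auto
        ultimately show False using nx by blast
      qed
    qed
    then have "insert x B \<in> ?\<A>" using B x by (simp add: indep_def)
    then have "insert x B = B" using max by blast
    then show False using nx gen_superset by blast
  qed
  then show ?thesis using B by blast
qed

section \<open>Homomorphisms with prescribed kernel\<close>

lemma nat_mult_Pair: "nat_mult n (x, y) = (nat_mult n x, nat_mult n y)"
  by (induction n) (auto simp: zero_prod_def)

text \<open>Zorn's lemma is applied to graphs of partial homomorphisms; requiring their values to lie in
  the span of the independent family \<open>j\<close> over the domain keeps \<open>j g\<close> available as the
  image of a new \<open>g\<close>.\<close>

lemma ex_hom_with_kernel:
  fixes P :: "'e::ab_group_add set" and j :: "'e \<Rightarrow> 'a::ab_group_add"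
  assumes p: "prime p" and P: "subgrp P" "\<And>x. nat_mult p x \<in> P"
    and j: "\<And>x. nat_mult p (j x) = 0" "\<And>g D. g \<notin> D \<Longrightarrow> j g \<notin> gen (j ` D)"
  shows "\<exists>\<phi>. (\<forall>x y. \<phi> (x - y) = \<phi> x - \<phi> y) \<and> (\<forall>x. \<phi> x = (0::'a) \<longleftrightarrow> x \<in> P)"
proof -
  have p1: "p \<ge> 1" using prime_ge_1_nat[OF p] .
  have subgen: "subgrp (gen (j ` D))" for D using j(1) by (intro subgrp_gen[OF p1]) auto
  \<comment> \<open>The clause on y = 0 does double duty: it prescribes the kernel and, applied to
    differences of pairs, makes the relation single-valued.\<close>
  define ok where "ok = (\<lambda>\<Gamma> :: ('e \<times> 'a) set. P \<times> {0} \<subseteq> \<Gamma> \<and>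
    (\<forall>x y. (x, y) \<in> \<Gamma> \<longrightarrow> nat_mult p y = 0 \<and> (y = 0 \<longleftrightarrow> x \<in> P) \<and> y \<in> gen (j ` fst ` \<Gamma>)))"
  let ?\<A> = "{\<Gamma>. subgrp \<Gamma> \<and> ok \<Gamma>}"
  have "\<exists>M\<in>?\<A>. \<forall>X\<in>?\<A>. M \<subseteq> X \<longrightarrow> X = M"
  proof (rule subset_Zorn_nonempty)
    have "subgrp (P \<times> {0::'a})" using P(1) by (auto simp: subgrp_def zero_prod_def)
    moreover have "ok (P \<times> {0})" using subgrp_zero[OF subgen] by (auto simp: ok_def)
    ultimately show "?\<A> \<noteq> {}" by blast
  next
    fix C assume C: "C \<noteq> {}" "subset.chain ?\<A> C"
    have okC: "ok \<Gamma>" if "\<Gamma> \<in> C" for \<Gamma> using C that by (auto simp: subset_chain_def)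
    have "subset.chain {H. subgrp H} C" using C by (auto simp: subset_chain_def)
    then have "subgrp (\<Union>C)" using C subgrp_Union_chain by blast
    moreover have "ok (\<Union>C)"
      unfolding ok_def
    proof (intro conjI)
      show "P \<times> {0} \<subseteq> \<Union>C" using C(1) okC unfolding ok_def by blast
      show "\<forall>x y. (x, y) \<in> \<Union>C \<longrightarrow> nat_mult p y = 0 \<and> (y = 0 \<longleftrightarrow> x \<in> P) \<and> y \<in> gen (j ` fst ` \<Union>C)"
      proof (rule allI, rule allI, rule impI)
        fix x y assume "(x, y) \<in> \<Union>C"
        then obtain \<Gamma> where \<Gamma>: "\<Gamma> \<in> C" "(x, y) \<in> \<Gamma>" by blast
        have "gen (j ` fst ` \<Gamma>) \<subseteq> gen (j ` fst ` \<Union>C)" using \<Gamma> by (intro gen_mono image_mono) blast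
        moreover have "nat_mult p y = 0 \<and> (y = 0 \<longleftrightarrow> x \<in> P) \<and> y \<in> gen (j ` fst ` \<Gamma>)"
          using okC[OF \<Gamma>(1)] \<Gamma>(2) by (simp add: ok_def)
        ultimately show "nat_mult p y = 0 \<and> (y = 0 \<longleftrightarrow> x \<in> P) \<and> y \<in> gen (j ` fst ` \<Union>C)"
          by blast
      qed
    qed
    ultimately show "\<Union>C \<in> ?\<A>" by blast
  qed
  then obtain \<Gamma> where "\<Gamma> \<in> ?\<A>" and max: "\<forall>X\<in>?\<A>. \<Gamma> \<subseteq> X \<longrightarrow> X = \<Gamma>" by (rule bexE)
  then have \<Gamma>: "subgrp \<Gamma>" "P \<times> {0} \<subseteq> \<Gamma>"
    and ok\<Gamma>: "\<And>x y. (x, y) \<in> \<Gamma> \<Longrightarrow> nat_mult p y = 0 \<and> (y = 0 \<longleftrightarrow> x \<in> P) \<and> y \<in> gen (j ` fst ` \<Gamma>)"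
    unfolding ok_def by auto
  define D where "D = fst ` \<Gamma>"
  have "subgrp D"
    unfolding subgrp_def D_def
  proof (intro conjI ballI)
    show "0 \<in> fst ` \<Gamma>" using subgrp_zero[OF \<Gamma>(1)] by (metis fst_zero imageI)
  next
    fix x y assume "x \<in> fst ` \<Gamma>" "y \<in> fst ` \<Gamma>"
    then obtain a b where "(x, a) \<in> \<Gamma>" "(y, b) \<in> \<Gamma>" by auto
    then have "(x - y, a - b) \<in> \<Gamma>" using subgrp_diff[OF \<Gamma>(1)] by fastforce
    then show "x - y \<in> fst ` \<Gamma>" by force
  qed
  have "P \<subseteq> D" using \<Gamma>(2) unfolding D_def by force
  have "g \<in> D" for g
  proof (rule ccontr)
    assume g: "g \<notin> D"
    define \<Delta> where "\<Delta> = adj \<Gamma> (g, j g)"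
    have "nat_mult p (g, j g) \<in> \<Gamma>" using \<Gamma>(2) P(2) j(1) by (auto simp: nat_mult_Pair)
    then have sub\<Delta>: "subgrp \<Delta>" unfolding \<Delta>_def by (rule subgrp_adj[OF \<Gamma>(1) p1])
    have \<Gamma>\<Delta>: "\<Gamma> \<subseteq> \<Delta>" unfolding \<Delta>_def by (rule adj_subset)
    have g\<Delta>: "(g, j g) \<in> \<Delta>" unfolding \<Delta>_def by (rule adj_self[OF \<Gamma>(1)])
    have jg: "j g \<notin> gen (j ` D)" using j(2) g by blast
    have "nat_mult p y = 0 \<and> (y = 0 \<longleftrightarrow> x \<in> P) \<and> y \<in> gen (j ` fst ` \<Delta>)" if "(x, y) \<in> \<Delta>" for x y
    proof -
      obtain k where k: "(x, y) - nat_mult k (g, j g) \<in> \<Gamma>" using \<open>(x, y) \<in> \<Delta>\<close> by (auto simp: \<Delta>_def adj_def)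
      define x0 where "x0 = x - nat_mult k g"
      define y0 where "y0 = y - nat_mult k (j g)"
      have xy: "x = x0 + nat_mult k g" "y = y0 + nat_mult k (j g)" by (simp_all add: x0_def y0_def)
      have in\<Gamma>: "(x0, y0) \<in> \<Gamma>" using k by (simp add: nat_mult_Pair x0_def y0_def)
      have x0D: "x0 \<in> D" using in\<Gamma> unfolding D_def by force
      note y0 = ok\<Gamma>[OF in\<Gamma>, folded D_def]
      have dvd: "nat_mult k g \<in> P" "nat_mult k (j g) = 0" if pk: "p dvd k"
      proof -
        obtain c where "k = c * p" using pk by (metis dvd_def mult.commute)
        then show "nat_mult k g \<in> P" "nat_mult k (j g) = 0"
          using P subgrp_mult j(1) by (auto simp: nat_mult_mult)
      qed
      \<comment> \<open>Either side of the equivalence forces p to divide k: otherwise y = 0 would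
        put j g into the span over D, and x \<in> P would put g into D. Once p divides k, adding k
        (g, j g) changes neither side.\<close>
      have "p dvd k" if "y = 0"
      proof (rule ccontr)
        assume "\<not> p dvd k"
        have "nat_mult k (j g) = - y0" using that xy(2) by (simp add: eq_neg_iff_add_eq_0 add.commute)
        then have "nat_mult k (j g) \<in> gen (j ` D)" using y0 subgrp_minus[OF subgen] by simp
        then show False
          using mem_if_prime_mult[OF subgen p _ \<open>\<not> p dvd k\<close>, of "j g" D] jg j(1) subgrp_zero[OF subgen] by simp
      qed
      moreover have "p dvd k" if "x \<in> P"
      proof (rule ccontr)
        assume "\<not> p dvd k"
        have "x - x0 \<in> D" using \<open>x \<in> P\<close> \<open>P \<subseteq> D\<close> x0D subgrp_diff[OF \<open>subgrp D\<close>] by blast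
        then have "nat_mult k g \<in> D" by (simp add: x0_def)
        then show False
          using mem_if_prime_mult[OF \<open>subgrp D\<close> p _ \<open>\<not> p dvd k\<close>, of g] g P(2) \<open>P \<subseteq> D\<close> by blast
      qed
      moreover have "y = 0 \<longleftrightarrow> x \<in> P" if "p dvd k"
      proof -
        have "x \<in> P \<longleftrightarrow> x0 \<in> P"
          using dvd(1)[OF that] subgrp_add[OF P(1)] subgrp_diff[OF P(1)] xy(1) by (metis add_diff_cancel_right')
        then show ?thesis using dvd(2)[OF that] y0 xy(2) by simp
      qed
      ultimately have iff: "y = 0 \<longleftrightarrow> x \<in> P" by blast
      have "gen (j ` D) \<subseteq> gen (j ` fst ` \<Delta>)" unfolding D_def using \<Gamma>\<Delta> by (intro gen_mono image_mono)
      moreover have "j g \<in> gen (j ` fst ` \<Delta>)" using g\<Delta> gen_superset by force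
      ultimately have "y \<in> gen (j ` fst ` \<Delta>)"
        using xy(2) y0 subgrp_add[OF subgen] subgrp_mult[OF subgen] by blast
      moreover have "nat_mult p y = 0"
        using xy(2) y0 j(1) by (simp add: nat_mult_plus mult.commute flip: nat_mult_mult) (simp add: nat_mult_mult j(1))
      ultimately show ?thesis using iff by blast
    qed
    moreover have "P \<times> {0} \<subseteq> \<Delta>" using \<Gamma>(2) \<Gamma>\<Delta> by blast
    ultimately have "ok \<Delta>" by (simp add: ok_def)
    then have "\<Delta> = \<Gamma>" using max sub\<Delta> \<Gamma>\<Delta> by blast
    then show False using g\<Delta> g unfolding D_def by force
  qed
  then have "\<forall>x. \<exists>y. (x, y) \<in> \<Gamma>" unfolding D_def by force
  then obtain \<phi> where \<phi>: "\<And>x. (x, \<phi> x) \<in> \<Gamma>" by metis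
  have unique: "y = z" if "(x, y) \<in> \<Gamma>" "(x, z) \<in> \<Gamma>" for x y z
  proof -
    have "(0, y - z) \<in> \<Gamma>" using subgrp_diff[OF \<Gamma>(1) that] by simp
    then show ?thesis using ok\<Gamma> subgrp_zero[OF P(1)] by fastforce
  qed
  have "\<phi> (x - y) = \<phi> x - \<phi> y" for x y
    using subgrp_diff[OF \<Gamma>(1) \<phi>[of x] \<phi>[of y]] \<phi>[of "x - y"] unique by simp
  moreover have "\<phi> x = 0 \<longleftrightarrow> x \<in> P" for x using ok\<Gamma>[OF \<phi>] by blast
  ultimately show ?thesis by blast
qed

section \<open>A compact open copy of (Z/p)^omega\<close>

lemma nat_fun_int_lepoll: "(UNIV :: (nat \<Rightarrow> int) set) \<lesssim> (UNIV :: nat set set)"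
proof -
  have "inj (\<lambda>f :: nat \<Rightarrow> int. range (\<lambda>i. prod_encode (i, int_encode (f i))))"
  proof (rule injI)
    fix f g :: "nat \<Rightarrow> int"
    assume eq: "range (\<lambda>i. prod_encode (i, int_encode (f i))) = range (\<lambda>i. prod_encode (i, int_encode (g i)))"
    show "f = g"
    proof
      fix i
      have "prod_encode (i, int_encode (f i)) \<in> range (\<lambda>i. prod_encode (i, int_encode (g i)))"
        using eq by blast
      then show "f i = g i" by (auto simp: int_encode_eq)
    qed
  qed
  then show ?thesis unfolding lepoll_def by blast
qed

lemma nat_mult_fun_int: "nat_mult n f i = int n * (f i :: int)"
  by (induction n) (auto simp: algebra_simps)

text \<open>A copy of \<open>(\<int>/p)\<^sup>\<omega>\<close>, presented as \<open>\<int>\<^sup>\<omega> / p \<int>\<^sup>\<omega>\<close>, is embedded as an open compact subgroup.\<close>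

lemma ex_compact_lin_base:
  assumes n: "n \<ge> 1" "\<And>x::'a::ab_group_add. nat_mult n x = 0"
    and c: "(UNIV :: nat set set) \<lesssim> (UNIV :: 'a set)"
  shows "\<exists>K :: nat \<Rightarrow> 'a set. (\<forall>n. subgrp (K n)) \<and> decseq K \<and> (\<Inter>n. K n) \<subseteq> {0} \<and> (\<forall>n. K n \<noteq> {0}) \<and>
    compactin (lin_top (range K)) (K 0)"
proof -
  have inf: "infinite (UNIV :: nat set set)" by (simp add: Finite_Set.finite_set)
  obtain p where p: "prime p" and "(UNIV :: nat set set) \<lesssim> {x \<in> UNIV::'a set. nat_mult p x = 0}"
    using infinite_lepoll_torsion[of "UNIV :: 'a set" n, OF _ _ n(1) inf c] n(2) by (auto simp: subgrp_def)
  then have cS: "(UNIV :: nat set set) \<lesssim> {x::'a. nat_mult p x = 0}" by simp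
  obtain B where B: "B \<subseteq> {x::'a. nat_mult p x = 0}" "indep B" "{x. nat_mult p x = 0} \<subseteq> gen B"
    using ex_independent_generating[OF p subgrp_torsion[of p]] by blast
  have "(UNIV :: nat set set) \<lesssim> gen B" using cS B(3) lepoll_trans subset_imp_lepoll by blast
  also have "gen B \<lesssim> lists B" unfolding gen_def by (rule image_lepoll)
  finally have cl: "(UNIV :: nat set set) \<lesssim> lists B" .
  have "infinite B"
  proof
    assume "finite B"
    \<comment> \<open>Lists over a finite set are countable, which contradicts Cantor's
      theorem.\<close>
    then have "countable (lists B)" by (simp add: countable_finite)
    then have "countable (UNIV :: nat set set)" using cl countable_lepoll by blast
    then have "(UNIV :: nat set set) \<lesssim> (UNIV :: nat set)" by (simp add: countable_def lepoll_def)
    then show False using lesspoll_Pow_self[of "UNIV :: nat set"] eqpoll_sym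
      lepoll_antisym[of "UNIV :: nat set set" "UNIV :: nat set"] unfolding lesspoll_def Pow_UNIV by blast
  qed
  \<comment> \<open>Every integer sequence gets its own independent element, so no basis of the
    quotient by P has to be chosen; the size of B allows this.\<close>
  then have "(UNIV :: (nat \<Rightarrow> int) set) \<lesssim> B"
    using lepoll_trans[OF nat_fun_int_lepoll lepoll_trans[OF cl lists_lepoll]] by blast
  then obtain j :: "(nat \<Rightarrow> int) \<Rightarrow> 'a" where j: "inj j" "range j \<subseteq> B" unfolding lepoll_def by blast
  define P where "P = {f :: nat \<Rightarrow> int. \<forall>i. int p dvd f i}"
  have "subgrp P" by (simp add: P_def subgrp_def)
  moreover have "nat_mult p f \<in> P" for f by (simp add: P_def nat_mult_fun_int)
  moreover have "nat_mult p (j f) = 0" for f using j B by blast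
  moreover have "j g \<notin> gen (j ` D)" if "g \<notin> D" for g D
  proof -
    have "j ` D \<subseteq> B - {j g}" using that j by (auto dest: injD)
    then have "gen (j ` D) \<subseteq> gen (B - {j g})" by (rule gen_mono)
    then show ?thesis using B(2) j(2) unfolding indep_def by blast
  qed
  ultimately obtain \<phi> where \<phi>: "\<And>x y. \<phi> (x - y) = \<phi> x - \<phi> y" "\<And>x. \<phi> x = (0::'a) \<longleftrightarrow> x \<in> P"
    using ex_hom_with_kernel[OF p, of P j] by blast
  \<comment> \<open>The Z n are basic neighbourhoods of zero in the product topology; their images K
    n start with the whole image of \<phi>.\<close>
  define Z where "Z = (\<lambda>n. {f :: nat \<Rightarrow> int. \<forall>i<n. f i = 0})"
  define K where "K = (\<lambda>n. \<phi> ` Z n)"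
  have sub: "subgrp (K n)" for n
    unfolding subgrp_def K_def
  proof (intro conjI ballI)
    have "0 = \<phi> 0" using \<phi>(2) by (simp add: P_def)
    then show "0 \<in> \<phi> ` Z n" by (intro image_eqI[of _ _ 0]) (simp_all add: Z_def)
  next
    fix x y assume "x \<in> \<phi> ` Z n" "y \<in> \<phi> ` Z n"
    then obtain f g where "x = \<phi> f" "y = \<phi> g" "f \<in> Z n" "g \<in> Z n" by blast
    then show "x - y \<in> \<phi> ` Z n" by (intro image_eqI[of _ _ "f - g"]) (auto simp: \<phi>(1) Z_def)
  qed
  have dec: "decseq K"
    unfolding decseq_def K_def by (intro allI impI image_mono) (auto simp: Z_def)
  have I: "(\<Inter>n. K n) \<subseteq> {0}"
  proof
    fix y assume y: "y \<in> (\<Inter>n. K n)"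
    then obtain f where f: "y = \<phi> f" unfolding K_def by blast
    have "int p dvd f i" for i
    proof -
      \<comment> \<open>Z n constrains only indices below n, so \<open>Suc i\<close> is what makes g
        vanish at i; then f i is congruent to 0 modulo p.\<close>
      obtain g where g: "y = \<phi> g" "g \<in> Z (Suc i)" using y unfolding K_def by blast
      then have "f - g \<in> P" using f \<phi> by (metis diff_self)
      then have "int p dvd (f - g) i" by (simp add: P_def)
      then show ?thesis using g(2) by (simp add: Z_def)
    qed
    then show "y \<in> {0}" using f \<phi>(2) by (simp add: P_def)
  qed
  have ne: "K n \<noteq> {0}" for n
  proof
    assume K0: "K n = {0}"
    define f where "f = (\<lambda>i. if i = n then 1 else 0 :: int)"
    have "\<phi> f \<in> K n" unfolding K_def by (intro imageI) (simp add: Z_def f_def)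
    then have "f \<in> P" using K0 \<phi>(2) by blast
    then have "int p dvd f n" by (simp add: P_def)
    then show False using prime_gt_1_nat[OF p] by (simp add: f_def)
  qed
  have L: "lin_base (range K)" using sub dec by (rule lin_base_decseq)
  \<comment> \<open>Sequences of residues below p form a compact set of representatives, by
    Tychonoff. \<phi> maps it onto K 0, continuously, since sequences agreeing below m have images
    that differ by an element of K m.\<close>
  define X where "X = product_topology (\<lambda>_::nat. discrete_topology {0..<int p}) UNIV"
  have topX: "topspace X = (\<Pi>\<^sub>E i\<in>UNIV. {0..<int p})" by (simp add: X_def)
  have "continuous_map X (lin_top (range K)) \<phi>"
    unfolding continuous_map_def
  proof (intro conjI allI impI)
    show "\<phi> \<in> topspace X \<rightarrow> topspace (lin_top (range K))" by (simp add: topspace_lin_top[OF L])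
  next
    fix U assume U: "openin (lin_top (range K)) U"
    show "openin X {f \<in> topspace X. \<phi> f \<in> U}"
    proof (subst openin_subopen, intro ballI)
      fix f assume f: "f \<in> {f \<in> topspace X. \<phi> f \<in> U}"
      then obtain m where m: "\<forall>b\<in>K m. \<phi> f + b \<in> U" using U unfolding openin_lin_top[OF L] by blast
      let ?W = "\<Pi>\<^sub>E i\<in>UNIV. if i < m then {f i} else {0..<int p}"
      have "openin X ?W"
        unfolding X_def
      proof (rule product_topology_basis)
        show "openin (discrete_topology {0..<int p}) (if i < m then {f i} else {0..<int p})" for i
          using f topX by (auto simp: PiE_iff)
        have "{i. (if i < m then {f i} else {0..<int p}) \<noteq> topspace (discrete_topology {0..<int p})} \<subseteq> {..<m}"
          by auto
        then show "finite {i. (if i < m then {f i} else {0..<int p}) \<noteq> topspace (discrete_topology {0..<int p})}"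
          by (rule finite_subset) simp
      qed
      moreover have "f \<in> ?W" using f topX by (auto simp: PiE_iff)
      moreover have "?W \<subseteq> {f \<in> topspace X. \<phi> f \<in> U}"
      proof
        fix g assume g: "g \<in> ?W"
        have "g - f \<in> Z m" using g by (auto simp: Z_def PiE_iff split: if_splits)
        then have "\<phi> f + \<phi> (g - f) \<in> U" using m unfolding K_def by blast
        moreover have "?W \<subseteq> topspace X" using f unfolding topX by (intro PiE_mono) (auto simp: PiE_iff)
        then have "g \<in> topspace X" using g by blast
        ultimately show "g \<in> {f \<in> topspace X. \<phi> f \<in> U}" by (simp add: \<phi>(1))
      qed
      ultimately show "\<exists>W. openin X W \<and> f \<in> W \<and> W \<subseteq> {f \<in> topspace X. \<phi> f \<in> U}" by blast
    qed
  qed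
  moreover have "compactin X (topspace X)"
    unfolding compact_space_def[symmetric] X_def by (simp add: compact_space_product_topology compact_space_discrete_topology)
  ultimately have "compactin (lin_top (range K)) (\<phi> ` topspace X)" by (rule image_compactin[rotated])
  moreover have "\<phi> ` topspace X = K 0"
  proof
    show "\<phi> ` topspace X \<subseteq> K 0" by (auto simp: K_def Z_def)
    show "K 0 \<subseteq> \<phi> ` topspace X"
    proof
      fix y assume "y \<in> K 0"
      then obtain f where f: "y = \<phi> f" unfolding K_def by blast
      define g where "g = (\<lambda>i. f i mod int p)"
      have "f - g \<in> P" by (auto simp: P_def g_def)
      then have "\<phi> f = \<phi> g" using \<phi> by (metis eq_iff_diff_eq_0)
      moreover have "g \<in> topspace X" using prime_gt_0_nat[OF p] by (simp add: topX PiE_iff g_def)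
      ultimately show "y \<in> \<phi> ` topspace X" using f by blast
    qed
  qed
  ultimately have "compactin (lin_top (range K)) (K 0)" by simp
  then show ?thesis using sub dec I ne by blast
qed

theorem theorem5p18:
  assumes "\<exists>n\<ge>1. range (nat_mult n :: 'a::ab_group_add \<Rightarrow> 'a) = {0}"
  shows "((UNIV :: nat set set) \<lesssim> (UNIV :: 'a set)
            \<longleftrightarrow> (\<exists>T :: 'a topology. T \<noteq> discrete_topology UNIV \<and> locally_minimal T \<and> locally_GTG T))
       \<and> ((\<exists>T :: 'a topology. T \<noteq> discrete_topology UNIV \<and> locally_minimal T \<and> locally_GTG T)
            \<longleftrightarrow> (\<exists>T :: 'a topology. T \<noteq> discrete_topology UNIV \<and> group_topology T
                   \<and> locally_compact_space T \<and> metrizable_space T))"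
proof -
  obtain n where n: "n \<ge> 1" "\<And>x::'a. nat_mult n x = 0" using assms by blast
  have "\<exists>T :: 'a topology. T \<noteq> discrete_topology UNIV \<and> locally_minimal T \<and> locally_GTG T \<and>
      group_topology T \<and> locally_compact_space T \<and> metrizable_space T"
    if c: "(UNIV :: nat set set) \<lesssim> (UNIV :: 'a set)"
  proof -
    obtain K :: "nat \<Rightarrow> 'a set" where K: "\<And>n. subgrp (K n)" "decseq K" "(\<Inter>n. K n) \<subseteq> {0}" "\<And>n. K n \<noteq> {0}"
      and compact: "compactin (lin_top (range K)) (K 0)"
      using ex_compact_lin_base[OF n c] by blast
    have L: "lin_base (range K)" using K(1,2) by (rule lin_base_decseq)
    note T = group_topology_lin_top[OF L]
    have "\<not> zero_nbhd (lin_top (range K)) {0}"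
      using K(4) subgrp_zero[OF K(1)] by (auto simp: zero_nbhd_lin_top[OF L])
    moreover have "zero_nbhd (lin_top (range K)) (K 0)" by (auto simp: zero_nbhd_lin_top[OF L])
    ultimately show ?thesis
      using T compact Hausdorff_lin_top[OF L K(3)] locally_minimal_if_compact_nbhd locally_compact_if_compact_nbhd
        locally_GTG_lin_top[OF L K(3)] metrizable_lin_top[OF K(1-3)] discrete_iff_zero_nbhd[OF T] by blast
  qed
  moreover note continuum_lepoll_if_locally_minimal_GTG[OF n] continuum_lepoll_if_locally_compact
  ultimately show ?thesis by blast
qed

end
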